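(* Let $s\ge t\ge 2$ be integers, let $\Gamma$ be a strongly regular graph with parameters $((ts+1)(s+1),(t+1)s,s-1,t+1)$, and let $v$ be a vertex of $\Gamma$. Then $v$ is a regular point if and only if the first subconstituent $\Gamma_1(v)$ is a disjoint union of cliques and, for every vertex $x\ne v$ not adjacent to $v$, the set $\{v,x\}^{\perp\perp}$ is a coclique of size $t+1$.
   Context: All graphs are finite, simple and undirected. A strongly regular graph with parameters $(\nu,k,\lambda,\mu)$ is a $k$-regular graph on $\nu$ vertices in which any two adjacent vertices have exactly $\lambda$ common neighbours and any two distinct non-adjacent vertices have exactly $\mu$ common neighbours. For a vertex $v$ of $\Gamma$, $\Gamma_i(v)$ denotes the graph induced on the set of vertices at distance $i$ from $v$. For a set $X$ of vertices, $X^{\perp}$ is the set of vertices that are equal or adjacent to each vertex of $X$ (each vertex counts as collinear with itself), and $X^{\perp\perp}=(X^{\perp})^{\perp}$. A coclique is a set of pairwise non-adjacent vertices. Regular point. A vertex $v$ of a strongly regular graph $\Gamma$ with parameters $((s+1)(st+1),s(t+1),s-1,t+1)$, $s\ge t\ge2$, is a regular point if $\Gamma_2(v)$ generates (i.e. the smallest association scheme on its vertex set containing its adjacency matrix is) a symmetric association scheme with relations ordered $I,B_1,B_2,B_3,B_4$, where $B_1$ is the adjacency matrix of $\Gamma_2(v)$, whose first eigenmatrix (columns indexed by the relations in this order, rows by the common eigenspaces in some order) is $$P=\begin{bmatrix} 1 & (s-1)(t+1) & (s-1)(t^2-1) & t-1 & (s-1)t(s-t)\\ 1 &s-1 & 1-s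 &-1 & 0\\ 1 &s-t-1 & (t-1)(s-t-1) &t-1 & -t(s-t)\\ 1 &-t-1 & t+1 &-1 & 0\\ 1 &-t-1 & 1-t^2 &t-1 & t^2 \end{bmatrix}.$$ If $s>t$ it is a $4$-class scheme; in the degenerate case $s=t$ the relation $B_4$ is empty and the last row and column of $P$ are omitted, so that it is a $3$-class scheme. *)

theory Defs
  imports Complex_Main "HOL-Library.Disjoint_Sets" "Graph_Theory.Graph_Theory"
begin

text \<open>
  A finite simple undirected graph is a digraph satisfying the locale predicate
  \<^term>\<open>graph\<close> of Graph\_Theory: finite, without loops or multiple arcs, with a symmetric
  adjacency relation \<^term>\<open>arcs_ends G\<close>.
\<close>

definition strongly_regular ::
    "('a, 'b) pre_digraph \<Rightarrow> nat \<Rightarrow> nat \<Rightarrow> nat \<Rightarrow> nat \<Rightarrow> bool" where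
  "strongly_regular G n k l m \<longleftrightarrow>
     graph G \<and> card (verts G) = n \<and>
     (\<forall>x\<in>verts G. card {z \<in> verts G. x \<rightarrow>\<^bsub>G\<^esub> z} = k) \<and>
     (\<forall>x\<in>verts G. \<forall>y\<in>verts G. x \<rightarrow>\<^bsub>G\<^esub> y \<longrightarrow>
        card {z \<in> verts G. x \<rightarrow>\<^bsub>G\<^esub> z \<and> y \<rightarrow>\<^bsub>G\<^esub> z} = l) \<and>
     (\<forall>x\<in>verts G. \<forall>y\<in>verts G. x \<noteq> y \<and> \<not> x \<rightarrow>\<^bsub>G\<^esub> y \<longrightarrow>
        card {z \<in> verts G. x \<rightarrow>\<^bsub>G\<^esub> z \<and> y \<rightarrow>\<^bsub>G\<^esub> z} = m)"

text \<open>
  The library function \<open>\<mu>\<close> is the least total weight of a walk; with all arc weights 1 it is the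
  distance in \<open>G\<close> (infinite for vertices in different components).
\<close>
definition subconstituent :: "('a, 'b) pre_digraph \<Rightarrow> nat \<Rightarrow> 'a \<Rightarrow> ('a, 'b) pre_digraph" where
  "subconstituent G i v =
     G \<restriction> {x \<in> verts G. wf_digraph.\<mu> G (\<lambda>_. 1) v x = ereal (real i)}"

definition perp :: "('a, 'b) pre_digraph \<Rightarrow> 'a set \<Rightarrow> 'a set" where
  "perp G X = {y \<in> verts G. \<forall>x\<in>X. y = x \<or> y \<rightarrow>\<^bsub>G\<^esub> x}"

definition coclique :: "('a, 'b) pre_digraph \<Rightarrow> 'a set \<Rightarrow> bool" where
  "coclique G C \<longleftrightarrow> C \<subseteq> verts G \<and> (\<forall>x\<in>C. \<forall>y\<in>C. \<not> x \<rightarrow>\<^bsub>G\<^esub> y)"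

definition disjoint_union_of_cliques :: "('a, 'b) pre_digraph \<Rightarrow> bool" where
  "disjoint_union_of_cliques H \<longleftrightarrow>
     (\<exists>\<C>. partition_on (verts H) \<C> \<and>
        (\<forall>x\<in>verts H. \<forall>y\<in>verts H. x \<rightarrow>\<^bsub>H\<^esub> y \<longleftrightarrow> x \<noteq> y \<and> (\<exists>C\<in>\<C>. x \<in> C \<and> y \<in> C)))"

text \<open>
  An association scheme is given by its set of (nonempty) relations.  Commutativity is not
  required here; it is automatic for symmetric schemes.
\<close>
definition association_scheme :: "'a set \<Rightarrow> ('a \<times> 'a) set set \<Rightarrow> bool" where
  "association_scheme X \<R> \<longleftrightarrow>
     finite X \<and> X \<noteq> {} \<and> partition_on (X \<times> X) \<R> \<and> Id_on X \<in> \<R> \<and>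
     (\<forall>R\<in>\<R>. R\<inverse> \<in> \<R>) \<and>
     (\<forall>R\<in>\<R>. \<forall>S\<in>\<R>. \<forall>T\<in>\<R>. \<exists>p. \<forall>(x, y)\<in>T. card {z \<in> X. (x, z) \<in> R \<and> (z, y) \<in> S} = p)"

definition symmetric_association_scheme :: "'a set \<Rightarrow> ('a \<times> 'a) set set \<Rightarrow> bool" where
  "symmetric_association_scheme X \<R> \<longleftrightarrow> association_scheme X \<R> \<and> (\<forall>R\<in>\<R>. sym R)"

text \<open>
  The 0/1 matrix of the relation \<open>A\<close> lies in the span of the adjacency matrices of the scheme
  exactly if \<open>A\<close> is a union of relations of the scheme.
\<close>
definition scheme_contains :: "('a \<times> 'a) set set \<Rightarrow> ('a \<times> 'a) set \<Rightarrow> bool" where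
  "scheme_contains \<R> A \<longleftrightarrow> (\<exists>\<S>\<subseteq>\<R>. A = \<Union>\<S>)"

text \<open>
  Schemes on a fixed set are ordered by inclusion of the spans of their adjacency matrices.
\<close>
definition generates_scheme :: "('a, 'b) pre_digraph \<Rightarrow> ('a \<times> 'a) set set \<Rightarrow> bool" where
  "generates_scheme H \<R> \<longleftrightarrow>
     association_scheme (verts H) \<R> \<and> scheme_contains \<R> (arcs_ends H) \<and>
     (\<forall>\<R>'. association_scheme (verts H) \<R>' \<and> scheme_contains \<R>' (arcs_ends H) \<longrightarrow>
        (\<forall>R\<in>\<R>. scheme_contains \<R>' R))"

text \<open>
  Vectors of \<open>\<real>\<^sup>X\<close> are functions of which only the values on \<open>X\<close> matter.  The set below consists
  of the vectors \<open>f\<close> with \<open>A\<^sub>j f = \<theta>\<^sub>j f\<close> for all \<open>j\<close>, where \<open>A\<^sub>j\<close> is the adjacency matrix of the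
  \<open>j\<close>-th relation of the list.
\<close>
definition common_eigenspace ::
    "'a set \<Rightarrow> ('a \<times> 'a) set list \<Rightarrow> (nat \<Rightarrow> real) \<Rightarrow> ('a \<Rightarrow> real) set" where
  "common_eigenspace X Rs \<theta> =
     {f. \<forall>j<length Rs. \<forall>x\<in>X. (\<Sum>y\<in>X. of_bool ((x, y) \<in> Rs ! j) * f y) = \<theta> j * f x}"

text \<open>
  The rows of \<open>P\<close> are the distinct eigenvalue tuples of nonzero common eigenspaces that together
  span \<open>\<real>\<^sup>X\<close>; hence these are all the common eigenspaces and the sum is direct.
\<close>
definition first_eigenmatrix ::
    "'a set \<Rightarrow> ('a \<times> 'a) set list \<Rightarrow> (nat \<Rightarrow> nat \<Rightarrow> real) \<Rightarrow> bool" where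
  "first_eigenmatrix X Rs P \<longleftrightarrow>
     (\<forall>i<length Rs. \<exists>f\<in>common_eigenspace X Rs (P i). \<exists>x\<in>X. f x \<noteq> 0) \<and>
     (\<forall>i<length Rs. \<forall>k<length Rs. i \<noteq> k \<longrightarrow> (\<exists>j<length Rs. P i j \<noteq> P k j)) \<and>
     (\<forall>f :: 'a \<Rightarrow> real. \<exists>g. (\<forall>i<length Rs. g i \<in> common_eigenspace X Rs (P i)) \<and>
        (\<forall>x\<in>X. f x = (\<Sum>i<length Rs. g i x)))"

definition regular_point_eigenmatrix :: "real \<Rightarrow> real \<Rightarrow> nat \<Rightarrow> nat \<Rightarrow> real" where
  "regular_point_eigenmatrix s t i j =
     [[1, (s - 1) * (t + 1), (s - 1) * (t\<^sup>2 - 1),        t - 1, (s - 1) * t * (s - t)],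
      [1, s - 1,             1 - s,                     -1,    0],
      [1, s - t - 1,         (t - 1) * (s - t - 1),     t - 1, - t * (s - t)],
      [1, - t - 1,           t + 1,                     -1,    0],
      [1, - t - 1,           1 - t\<^sup>2,                    t - 1, t\<^sup>2]] ! i ! j"

text \<open>
  For \<open>s = t\<close> the list has only four relations, so that
  \<^const>\<open>first_eigenmatrix\<close> ignores the last row and column of the matrix above.
\<close>
definition regular_point :: "('a, 'b) pre_digraph \<Rightarrow> nat \<Rightarrow> nat \<Rightarrow> 'a \<Rightarrow> bool" where
  "regular_point G s t v \<longleftrightarrow>
     2 \<le> t \<and> t \<le> s \<and>
     strongly_regular G ((s + 1) * (s * t + 1)) (s * (t + 1)) (s - 1) (t + 1) \<and> v \<in> verts G \<and>
     (let H = subconstituent G 2 v in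
      \<exists>Rs. length Rs = (if s = t then 4 else 5) \<and> distinct Rs \<and>
        Rs ! 0 = Id_on (verts H) \<and> Rs ! 1 = arcs_ends H \<and>
        generates_scheme H (set Rs) \<and> symmetric_association_scheme (verts H) (set Rs) \<and>
        first_eigenmatrix (verts H) Rs (regular_point_eigenmatrix (real s) (real t)))"

end

theory Submission
  imports Defs
begin

text \<open>
  Write \<open>H = \<Gamma>\<^sub>2(v)\<close> and, for \<open>x \<in> H\<close>, let \<open>M x\<close> be the set of the \<open>t + 1\<close> common neighbours of \<open>v\<close>
  and \<open>x\<close>, so that \<open>M x = {v, x}\<^sup>\<bottom>\<close>. Both sides of the equivalence are shown to say the same thing
  about the map \<open>M\<close>, called the net at \<open>v\<close> below: each fibre of \<open>M\<close> has \<open>t\<close> elements, two different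
  sets \<open>M x\<close>, \<open>M y\<close> share at most one vertex, adjacent \<open>x\<close>, \<open>y\<close> have different but meeting sets, and
  when \<open>M x\<close> and \<open>M y\<close> are different and meet, \<open>x\<close> has exactly one neighbour in the fibre of \<open>y\<close>.
  The fibre of \<open>x\<close> is \<open>{v, x}\<^sup>\<bottom>\<^sup>\<bottom>\<close> without \<open>v\<close>. The fibres are the points of a net whose lines are the
  vertices of \<open>\<Gamma>\<^sub>1(v)\<close>, and the cliques of \<open>\<Gamma>\<^sub>1(v)\<close> are its parallel classes.

  That the two local conditions are equivalent to the net (\<open>local_conditions_iff_net\<close>) is double
  counting with the parameters. The sharpest tool is that two nonadjacent vertices have exactly
  \<open>t + 1\<close> common neighbours: if \<open>p\<close>, \<open>r\<close> are different elements of \<open>M x\<close>, then \<open>v\<close> and the \<open>t\<close> elements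
  of the fibre of \<open>x\<close> already are all of their common neighbours.

  For the passage to association schemes let \<open>B\<^sub>1\<close> be adjacency in \<open>H\<close> and, among nonadjacent pairs of
  different vertices, let \<open>B\<^sub>2\<close>, \<open>B\<^sub>3\<close>, \<open>B\<^sub>4\<close> say that \<open>M x\<close> and \<open>M y\<close> are different and meet, are equal,
  are disjoint. The number of common neighbours of \<open>x\<close> and \<open>y\<close> inside \<open>H\<close> is \<open>\<lambda>\<close> or \<open>\<mu>\<close> minus
  \<open>\<bar>M x \<inter> M y\<bar>\<close>. Hence the net is equivalent to three product formulas,
  \<open>B\<^sub>1B\<^sub>1 = (s - 1)(t + 1)I + (s - 2)B\<^sub>1 + tB\<^sub>2 + (t + 1)B\<^sub>4\<close>, \<open>B\<^sub>1B\<^sub>3 = B\<^sub>2\<close> and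
  \<open>B\<^sub>3B\<^sub>3 = (t - 1)I + (t - 2)B\<^sub>3\<close> (\<open>net_imp_table\<close> and \<open>table_imp_net\<close>).

  These formulas are in turn equivalent to the eigenmatrix. From left to right, vectors split into
  constants, vectors with sum zero that are constant on fibres, and vectors with sum zero on each
  fibre; on each of the last two spaces \<open>B\<^sub>1\<close> satisfies a quadratic equation, whose roots give the
  rows of \<open>P\<close> (\<open>first_eigenmatrix_Rs\<close>). From right to left, a product formula for the columns of \<open>P\<close>
  is a product formula for the adjacency matrices, since the common eigenspaces span
  (\<open>intersection_numbers_from_eigenmatrix\<close>). The latter principle also yields that the relations form
  an association scheme, because the span of the columns of \<open>P\<close> is closed under entrywise products
  (\<open>regP_products\<close>). Finally the scheme is generated by \<open>B\<^sub>1\<close>: the entries of \<open>B\<^sub>1B\<^sub>1\<close> on \<open>B\<^sub>2\<close>, \<open>B\<^sub>3\<close>,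
  \<open>B\<^sub>4\<close> are \<open>t\<close>, \<open>0\<close>, \<open>t + 1\<close>, so \<open>B\<^sub>1\<close> and \<open>B\<^sub>1B\<^sub>1\<close> separate all relations.
\<close>

section \<open>Adjacency operators and intersection numbers\<close>

definition adj_op :: "'a set \<Rightarrow> ('a \<times> 'a) set \<Rightarrow> ('a \<Rightarrow> real) \<Rightarrow> 'a \<Rightarrow> real" where
  "adj_op X R f x = (\<Sum>y\<in>X. of_bool ((x, y) \<in> R) * f y)"

lemma adj_op_cong:
  assumes "\<And>y. y \<in> X \<Longrightarrow> f y = g y"
  shows "adj_op X R f x = adj_op X R g x"
  unfolding adj_op_def using assms by (intro sum.cong) auto

lemma adj_op_linear:
  "adj_op X R (\<lambda>y. a * f y + b * g y) x = a * adj_op X R f x + b * adj_op X R g x"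
  unfolding adj_op_def by (simp add: sum.distrib sum_distrib_left algebra_simps)

lemma adj_op_scale: "adj_op X R (\<lambda>y. a * f y) x = a * adj_op X R f x"
  using adj_op_linear[of X R a f 0 f x] by simp

lemma adj_op_sum:
  "adj_op X R (\<lambda>y. \<Sum>i\<in>I. f i y) x = (\<Sum>i\<in>I. adj_op X R (f i) x)"
  unfolding adj_op_def sum_distrib_left by (rule sum.swap)

lemma adj_op_comp:
  assumes "finite X"
  shows "adj_op X R (adj_op X S f) x
    = (\<Sum>w\<in>X. real (card {z \<in> X. (x, z) \<in> R \<and> (z, w) \<in> S}) * f w)"
proof -
  have card: "real (card {z \<in> X. (x, z) \<in> R \<and> (z, w) \<in> S})
      = (\<Sum>z\<in>X. of_bool ((x, z) \<in> R) * of_bool ((z, w) \<in> S))" for w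
  proof -
    have "(\<Sum>z\<in>X. of_bool ((x, z) \<in> R) * of_bool ((z, w) \<in> S) :: real)
        = (\<Sum>z\<in>X. of_bool ((x, z) \<in> R \<and> (z, w) \<in> S))"
      by (intro sum.cong) auto
    also have "\<dots> = real (card {z \<in> X. (x, z) \<in> R \<and> (z, w) \<in> S})"
      using assms by (simp add: Collect_conj_eq)
    finally show ?thesis by simp
  qed
  have "adj_op X R (adj_op X S f) x
      = (\<Sum>z\<in>X. \<Sum>w\<in>X. of_bool ((x, z) \<in> R) * of_bool ((z, w) \<in> S) * f w)"
    by (simp only: adj_op_def sum_distrib_left mult.assoc)
  also have "\<dots> = (\<Sum>w\<in>X. \<Sum>z\<in>X. of_bool ((x, z) \<in> R) * of_bool ((z, w) \<in> S) * f w)"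
    by (rule sum.swap)
  finally show ?thesis by (simp only: card sum_distrib_right)
qed

lemma sum_times_delta:
  fixes c :: "'a \<Rightarrow> real"
  assumes "finite X" "w \<in> X"
  shows "(\<Sum>y\<in>X. c y * of_bool (y = w)) = c w"
proof -
  have "(\<Sum>y\<in>X. c y * of_bool (y = w)) = (\<Sum>y\<in>X. if y = w then c w else 0)"
    by (intro sum.cong) auto
  then show ?thesis using assms by simp
qed

lemma adj_op_delta:
  assumes "finite X" "w \<in> X"
  shows "adj_op X R (\<lambda>y. of_bool (y = w)) x = of_bool ((x, w) \<in> R)"
  unfolding adj_op_def using assms by (rule sum_times_delta)

lemma common_eigenspace_iff:
  "f \<in> common_eigenspace X Rs \<theta> \<longleftrightarrow>
    (\<forall>j<length Rs. \<forall>x\<in>X. adj_op X (Rs ! j) f x = \<theta> j * f x)"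
  by (simp add: common_eigenspace_def adj_op_def)

text \<open>
  On the common eigenspace belonging to row \<open>i\<close>, the product of the \<open>a\<close>-th and \<open>b\<close>-th adjacency
  matrices acts as the scalar \<open>P i a * P i b\<close>. A linear relation between this product of columns
  and the columns of \<open>P\<close> therefore holds between the matrices on each eigenspace, hence on the
  unit vector at \<open>w\<close>, whose image at \<open>x\<close> is the matrix entry.
\<close>
lemma intersection_numbers_from_eigenmatrix:
  assumes P: "first_eigenmatrix X Rs P" and "finite X"
    and a: "a < length Rs" and b: "b < length Rs" 
    and prod: "\<And>i. i < length Rs \<Longrightarrow> P i a * P i b = (\<Sum>j<length Rs. c j * P i j)"
    and x: "x \<in> X" and w: "w \<in> X"
  shows "real (card {z \<in> X. (x, z) \<in> Rs ! a \<and> (z, w) \<in> Rs ! b})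
    = (\<Sum>j<length Rs. c j * of_bool ((x, w) \<in> Rs ! j))"
proof -
  let ?n = "length Rs" and ?d = "\<lambda>y. of_bool (y = w) :: real"
  have "\<exists>g. (\<forall>i<?n. g i \<in> common_eigenspace X Rs (P i)) \<and> (\<forall>y\<in>X. ?d y = (\<Sum>i<?n. g i y))"
    using P unfolding first_eigenmatrix_def by (elim conjE) (erule spec)
  then obtain g where g: "\<And>i. i < ?n \<Longrightarrow> g i \<in> common_eigenspace X Rs (P i)"
    and d: "\<And>y. y \<in> X \<Longrightarrow> ?d y = (\<Sum>i<?n. g i y)"
    by auto
  have op: "adj_op X (Rs ! j) ?d y = (\<Sum>i<?n. P i j * g i y)" if "j < ?n" "y \<in> X" for j y
  proof -
    have "adj_op X (Rs ! j) ?d y = adj_op X (Rs ! j) (\<lambda>y. \<Sum>i<?n. g i y) y"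
      by (rule adj_op_cong) (rule d)
    also have "\<dots> = (\<Sum>i<?n. adj_op X (Rs ! j) (g i) y)" by (rule adj_op_sum)
    also have "\<dots> = (\<Sum>i<?n. P i j * g i y)"
      using g that by (intro sum.cong) (auto simp: common_eigenspace_iff)
    finally show ?thesis .
  qed
  have "real (card {z \<in> X. (x, z) \<in> Rs ! a \<and> (z, w) \<in> Rs ! b})
      = adj_op X (Rs ! a) (adj_op X (Rs ! b) ?d) x"
    using adj_op_comp[OF \<open>finite X\<close>, of "Rs ! a" "Rs ! b" ?d x] sum_times_delta[OF \<open>finite X\<close> w]
    by simp
  also have "\<dots> = adj_op X (Rs ! a) (\<lambda>y. \<Sum>i<?n. P i b * g i y) x"
    by (rule adj_op_cong) (rule op[OF b])
  also have "\<dots> = (\<Sum>i<?n. P i b * adj_op X (Rs ! a) (g i) x)"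
    by (simp add: adj_op_sum adj_op_scale)
  also have "\<dots> = (\<Sum>i<?n. (P i a * P i b) * g i x)"
    using g a x by (intro sum.cong) (auto simp: common_eigenspace_iff)
  also have "\<dots> = (\<Sum>i<?n. (\<Sum>j<?n. c j * P i j) * g i x)"
    using prod by (intro sum.cong) auto
  also have "\<dots> = (\<Sum>j<?n. c j * (\<Sum>i<?n. P i j * g i x))"
    unfolding sum_distrib_left sum_distrib_right mult.assoc by (rule sum.swap)
  also have "\<dots> = (\<Sum>j<?n. c j * of_bool ((x, w) \<in> Rs ! j))"
    using x by (intro sum.cong) (simp_all add: adj_op_delta[OF \<open>finite X\<close> w] op[symmetric])
  finally show ?thesis .
qed

abbreviation regP :: "nat \<Rightarrow> nat \<Rightarrow> nat \<Rightarrow> nat \<Rightarrow> real" where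
  "regP s t \<equiv> regular_point_eigenmatrix (real s) (real t)"

lemma all_less_5: "(\<forall>i<5. Q i) \<longleftrightarrow> Q 0 \<and> Q 1 \<and> Q 2 \<and> Q 3 \<and> Q (4::nat)"
  by (auto simp: eval_nat_numeral less_Suc_eq)

lemma sum_less_5: "(\<Sum>i<5. f i) = f 0 + f 1 + f 2 + f 3 + f (4::nat)" for f :: "nat \<Rightarrow> real"
  by (simp add: eval_nat_numeral)

lemma sum_less_4: "(\<Sum>i<4. f i) = f 0 + f 1 + f 2 + f (3::nat)" for f :: "nat \<Rightarrow> real"
  by (simp add: eval_nat_numeral)

lemma regP_entries:
  "regP s t 0 0 = 1"
  "regP s t 0 1 = (real s - 1) * (real t + 1)"
  "regP s t 0 2 = (real s - 1) * (real t ^ 2 - 1)"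
  "regP s t 0 3 = real t - 1"
  "regP s t 0 4 = (real s - 1) * real t * (real s - real t)"
  "regP s t 1 0 = 1"
  "regP s t 1 1 = real s - 1"
  "regP s t 1 2 = 1 - real s"
  "regP s t 1 3 = - 1"
  "regP s t 1 4 = 0"
  "regP s t 2 0 = 1"
  "regP s t 2 1 = real s - real t - 1"
  "regP s t 2 2 = (real t - 1) * (real s - real t - 1)"
  "regP s t 2 3 = real t - 1"
  "regP s t 2 4 = - real t * (real s - real t)"
  "regP s t 3 0 = 1"
  "regP s t 3 1 = - real t - 1"
  "regP s t 3 2 = real t + 1"
  "regP s t 3 3 = - 1"
  "regP s t 3 4 = 0"
  "regP s t 4 0 = 1"
  "regP s t 4 1 = - real t - 1"
  "regP s t 4 2 = 1 - real t ^ 2"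
  "regP s t 4 3 = real t - 1"
  "regP s t 4 4 = real t ^ 2"
  by (simp_all add: regular_point_eigenmatrix_def)

lemmas regP_simps = regP_entries[unfolded One_nat_def]

text \<open>
  Naming the five coefficients turns a product of two columns into five polynomial identities.
\<close>
lemma expand_in_columns:
  fixes P :: "nat \<Rightarrow> nat \<Rightarrow> real"
  assumes "\<forall>i<5. u i = c0 * P i 0 + c1 * P i 1 + c2 * P i 2 + c3 * P i 3 + c4 * P i 4"
  shows "\<exists>c. \<forall>i<5. u i = (\<Sum>j<5. c j * P i j)"
  by (rule exI[of _ "(!) [c0, c1, c2, c3, c4]"]) (use assms in \<open>simp add: sum_less_5\<close>)

text \<open>
  These are the three product formulas that define the multiplication table below; all others
  follow from them.
\<close>
lemma regP_products_explicit:
  "\<forall>i<5. regP s t i 1 * regP s t i 1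
    = (real s - 1) * (real t + 1) * regP s t i 0 + (real s - 2) * regP s t i 1
      + real t * regP s t i 2 + 0 * regP s t i 3 + (real t + 1) * regP s t i 4"
  "\<forall>i<5. regP s t i 1 * regP s t i 3
    = 0 * regP s t i 0 + 0 * regP s t i 1 + 1 * regP s t i 2 + 0 * regP s t i 3 + 0 * regP s t i 4"
  "\<forall>i<5. regP s t i 3 * regP s t i 3
    = (real t - 1) * regP s t i 0 + 0 * regP s t i 1 + 0 * regP s t i 2
      + (real t - 2) * regP s t i 3 + 0 * regP s t i 4"
  by (unfold all_less_5 regP_entries, intro conjI; algebra)+

text \<open>
  The coefficients are the intersection numbers of the scheme. They are obtained from the three
  formulas above by associativity: \<open>B\<^sub>2 = B\<^sub>1B\<^sub>3\<close> and \<open>B\<^sub>4B\<^sub>3 = (t - 1)B\<^sub>4\<close> reduce the products with \<open>B\<^sub>2\<close>,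
  and the products with \<open>B\<^sub>4\<close> come from expressing \<open>B\<^sub>4\<close> by the all-one matrix.
\<close>
lemma regP_products_ordered:
  assumes "a \<le> b" "b < 5"
  shows "\<exists>c. \<forall>i<5. regP s t i a * regP s t i b = (\<Sum>j<5. c j * regP s t i j)"
proof -
  define S T where "S = real s" and "T = real t"
  define k where "k = (S - 1) * (T + 1)"
  \<comment> \<open>The coefficient of \<open>B\<^sub>2\<close> in \<open>B\<^sub>1B\<^sub>2\<close>, which recurs in \<open>B\<^sub>2B\<^sub>2\<close>.\<close>
  define q where "q = S - 2 + T * (T - 2)"
  note entries = regP_entries k_def q_def S_def T_def
  have "b = 0 \<or> b = 1 \<or> b = 2 \<or> b = 3 \<or> b = 4" using \<open>b < 5\<close> by linarith
  moreover have "a = 0 \<or> a = 1 \<or> a = 2 \<or> a = 3 \<or> a = 4" using assms by linarith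
  ultimately consider "a = 0" | "a = 1" "b = 1" | "a = 1" "b = 2" | "a = 1" "b = 3" | "a = 1" "b = 4"
    | "a = 2" "b = 2" | "a = 2" "b = 3" | "a = 2" "b = 4" | "a = 3" "b = 3" | "a = 3" "b = 4" | "a = 4" "b = 4"
    using \<open>a \<le> b\<close> by (elim disjE; simp)
  then show ?thesis
  proof cases
    case 1
    have "regP s t i 0 = 1" if "i < 5" for i
    proof -
      have "\<forall>i<5. regP s t i 0 = 1" unfolding all_less_5 regP_entries by simp
      then show ?thesis using that by simp
    qed
    with \<open>b < 5\<close> show ?thesis
      by (intro exI[of _ "\<lambda>j. of_bool (j = b)"]) (auto simp: 1 sum.delta)
  next
    case 2
    show ?thesis unfolding 2 by (rule expand_in_columns[OF regP_products_explicit(1)])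
  next
    case 3
    show ?thesis unfolding 3
      by (rule expand_in_columns[of _ 0 _ "T*(T-1)" q k "T^2-1"])
        (unfold all_less_5 entries, intro conjI; algebra)
  next
    case 4
    show ?thesis unfolding 4 by (rule expand_in_columns[OF regP_products_explicit(2)])
  next
    case 5
    show ?thesis unfolding 5
      by (rule expand_in_columns[of _ 0 _ "T*(S-T)" "T*(S-T)" 0 "(T+1)*(S-1-T)"])
        (unfold all_less_5 entries, intro conjI; algebra)
  next
    case 6
    show ?thesis unfolding 6
      by (rule expand_in_columns[of _ "k*(T-1)" _ "q*(T-1)" "q*(T-2)+T*(T-1)" "k*(T-2)" "(T^2-1)*(T-1)"])
        (unfold all_less_5 entries, intro conjI; algebra)
  next
    case 7
    show ?thesis unfolding 7
      by (rule expand_in_columns[of _ 0 _ "T-1" "T-2" 0 0])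
        (unfold all_less_5 entries, intro conjI; algebra)
  next
    case 8
    show ?thesis unfolding 8
      by (rule expand_in_columns[of _ 0 _ "(T-1)*(T*(S-T))" "(T-1)*(T*(S-T))" 0 "(T-1)*((T+1)*(S-1-T))"])
        (unfold all_less_5 entries, intro conjI; algebra)
  next
    case 9
    show ?thesis unfolding 9 by (rule expand_in_columns[OF regP_products_explicit(3)])
  next
    case 10
    show ?thesis unfolding 10
      by (rule expand_in_columns[of _ 0 _ 0 0 0 "T-1"])
        (unfold all_less_5 entries, intro conjI; algebra)
  next
    case 11
    show ?thesis unfolding 11
      by (rule expand_in_columns[of _ "(S-1)*T*(S-T)" _ "(S-1)*T*(S-T)-T^2*(S-T)" "(S-1)*T*(S-T)-T^2*(S-T)" "(S-1)*T*(S-T)" "(S-1)*T*(S-T)-T-T*(T+1)*(S-1-T)"])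
        (unfold all_less_5 entries, intro conjI; algebra)
  qed
qed

text \<open>
  For \<open>s = t\<close> the fifth column vanishes in the first four rows, so that the degenerate case needs
  no formulas of its own.
\<close>
lemma regP_sum_truncate:
  assumes "i < m" "m = (if s = t then 4 else 5)"
  shows "(\<Sum>j<m. c j * regP s t i j) = (\<Sum>j<5. c j * regP s t i j)"
proof (cases "s = t")
  case True
  then have "i = 0 \<or> i = 1 \<or> i = 2 \<or> i = 3" using assms by auto
  then have "regP s t i 4 = 0"
    using True by (auto simp: regular_point_eigenmatrix_def)
  with True assms(2) show ?thesis by (simp add: eval_nat_numeral)
qed (use assms in simp)

lemma regP_products:
  assumes "a < m" "b < m" and m: "m = (if s = t then 4 else 5)"
  shows "\<exists>c. \<forall>i<m. regP s t i a * regP s t i b = (\<Sum>j<m. c j * regP s t i j)"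
proof -
  have "\<exists>c. \<forall>i<5. regP s t i a * regP s t i b = (\<Sum>j<5. c j * regP s t i j)"
  proof (cases "a \<le> b")
    case True
    then show ?thesis using assms by (intro regP_products_ordered) (auto split: if_splits)
  next
    case False
    then have "\<exists>c. \<forall>i<5. regP s t i b * regP s t i a = (\<Sum>j<5. c j * regP s t i j)"
      using assms by (intro regP_products_ordered) (auto split: if_splits)
    then show ?thesis by (simp add: mult.commute)
  qed
  then obtain c where c: "regP s t i a * regP s t i b = (\<Sum>j<5. c j * regP s t i j)" if "i < 5" for i
    by blast
  have "m \<le> 5" using m by simp
  show ?thesis
  proof (intro exI allI impI)
    fix i assume "i < m"
    with \<open>m \<le> 5\<close> show "regP s t i a * regP s t i b = (\<Sum>j<m. c j * regP s t i j)"
      using c[of i] regP_sum_truncate[OF _ m, of i c] by simp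
  qed
qed

lemma regP_intersection_numbers:
  assumes P: "first_eigenmatrix X Rs (regP s t)" and "finite X"
    and len: "length Rs = (if s = t then 4 else 5)"
    and ab: "a < length Rs" "b < length Rs" and xw: "x \<in> X" "w \<in> X"
    and prod: "\<forall>i<5. regP s t i a * regP s t i b
      = c0 * regP s t i 0 + c1 * regP s t i 1 + c2 * regP s t i 2 + c3 * regP s t i 3 + c4 * regP s t i 4"
  shows "real (card {z \<in> X. (x, z) \<in> Rs ! a \<and> (z, w) \<in> Rs ! b})
    = c0 * of_bool ((x, w) \<in> Rs ! 0) + c1 * of_bool ((x, w) \<in> Rs ! 1)
      + c2 * of_bool ((x, w) \<in> Rs ! 2) + c3 * of_bool ((x, w) \<in> Rs ! 3)
      + c4 * of_bool ((x, w) \<in> (if s = t then {} else Rs ! 4))"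
proof -
  let ?c = "(!) [c0, c1, c2, c3, c4]"
  have "real (card {z \<in> X. (x, z) \<in> Rs ! a \<and> (z, w) \<in> Rs ! b})
      = (\<Sum>j<length Rs. ?c j * of_bool ((x, w) \<in> Rs ! j))"
  proof (rule intersection_numbers_from_eigenmatrix[OF P \<open>finite X\<close> ab _ xw])
    fix i assume i: "i < length Rs"
    then have "i < 5" using len by (simp split: if_splits)
    then have "regP s t i a * regP s t i b = (\<Sum>j<5. ?c j * regP s t i j)"
      using prod by (simp add: sum_less_5)
    then show "regP s t i a * regP s t i b = (\<Sum>j<length Rs. ?c j * regP s t i j)"
      using regP_sum_truncate[OF i len] by simp
  qed
  also have "\<dots> = c0 * of_bool ((x, w) \<in> Rs ! 0) + c1 * of_bool ((x, w) \<in> Rs ! 1)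
      + c2 * of_bool ((x, w) \<in> Rs ! 2) + c3 * of_bool ((x, w) \<in> Rs ! 3)
      + c4 * of_bool ((x, w) \<in> (if s = t then {} else Rs ! 4))"
  proof (cases "s = t")
    case True
    then have len4: "length Rs = 4" using len by simp
    show ?thesis unfolding len4 sum_less_4 using True by simp
  next
    case False
    then have len5: "length Rs = 5" using len by simp
    show ?thesis unfolding len5 sum_less_5 using False by simp
  qed
  finally show ?thesis .
qed

section \<open>The eigenmatrix of a multiplication table\<close>

text \<open>
  The three product formulas together with the size of \<open>X\<close> determine everything else: the
  eigenmatrix, the scheme property, and that \<open>B4\<close> is empty exactly for \<open>s = t\<close>. The assumption
  \<open>exactly_one\<close> says that the identity and the four relations partition \<open>X \<times> X\<close>, in the additive
  form in which it is used for matrices.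
\<close>
locale regular_multiplication_table =
  fixes X :: "'a set" and s t :: nat and B1 B2 B3 B4 :: "('a \<times> 'a) set"
  assumes t_ge_2: "2 \<le> t" and t_le_s: "t \<le> s"
    and finite_X: "finite X" and card_X: "card X = s^2 * t"
    and sub: "B1 \<subseteq> X \<times> X" "B2 \<subseteq> X \<times> X" "B3 \<subseteq> X \<times> X" "B4 \<subseteq> X \<times> X"
    and sym: "sym B1" "sym B2" "sym B3" "sym B4"
    and exactly_one: "\<And>x y. x \<in> X \<Longrightarrow> y \<in> X \<Longrightarrow>
        of_bool (x = y) + of_bool ((x, y) \<in> B1) + of_bool ((x, y) \<in> B2)
          + of_bool ((x, y) \<in> B3) + of_bool ((x, y) \<in> B4) = (1::real)"
    and B1_B1: "\<And>x y. x \<in> X \<Longrightarrow> y \<in> X \<Longrightarrow>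
        real (card {z \<in> X. (x, z) \<in> B1 \<and> (z, y) \<in> B1})
          = (real s - 1) * (real t + 1) * of_bool (x = y) + (real s - 2) * of_bool ((x, y) \<in> B1)
            + real t * of_bool ((x, y) \<in> B2) + (real t + 1) * of_bool ((x, y) \<in> B4)"
    and B1_B3: "\<And>x y. x \<in> X \<Longrightarrow> y \<in> X \<Longrightarrow>
        real (card {z \<in> X. (x, z) \<in> B1 \<and> (z, y) \<in> B3}) = of_bool ((x, y) \<in> B2)"
    and B3_B3: "\<And>x y. x \<in> X \<Longrightarrow> y \<in> X \<Longrightarrow>
        real (card {z \<in> X. (x, z) \<in> B3 \<and> (z, y) \<in> B3})
          = (real t - 1) * of_bool (x = y) + (real t - 2) * of_bool ((x, y) \<in> B3)"
begin

abbreviation A where "A \<equiv> adj_op X B1"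
abbreviation D where "D \<equiv> adj_op X B3"

definition "k = (real s - 1) * (real t + 1)"

lemma st_real: "2 \<le> real t" "real t \<le> real s" "real s > 0" "real t > 0"
  using t_ge_2 t_le_s by auto

lemma real_card_X: "real (card X) = real s ^ 2 * real t"
  by (simp add: card_X)

lemma diag: "x \<in> X \<Longrightarrow> (x, x) \<notin> B1 \<and> (x, x) \<notin> B2 \<and> (x, x) \<notin> B3 \<and> (x, x) \<notin> B4"
  using exactly_one[of x x] by (auto simp: of_bool_def split: if_splits)

lemma delta_sum: "x \<in> X \<Longrightarrow> (\<Sum>y\<in>X. of_bool (x = y) * f y) = f x" for f :: "'a \<Rightarrow> real"
  using sum_times_delta[OF finite_X, of x f] by (simp only: mult.commute eq_commute[of x])

lemma total_op:
  assumes "x \<in> X"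
  shows "f x + A f x + adj_op X B2 f x + D f x + adj_op X B4 f x = sum f X"
proof -
  have "f x + A f x + adj_op X B2 f x + D f x + adj_op X B4 f x
     = (\<Sum>y\<in>X. (of_bool (x = y) + of_bool ((x, y) \<in> B1) + of_bool ((x, y) \<in> B2)
          + of_bool ((x, y) \<in> B3) + of_bool ((x, y) \<in> B4)) * f y)"
    unfolding adj_op_def distrib_right sum.distrib delta_sum[OF assms] ..
  also have "\<dots> = sum f X"
    using exactly_one[OF assms] by (intro sum.cong) auto
  finally show ?thesis .
qed

lemma op_of_counts:
  assumes x: "x \<in> X" 
    and "\<And>y. y \<in> X \<Longrightarrow> real (card {z \<in> X. (x, z) \<in> R \<and> (z, y) \<in> S})
      = c0 * of_bool (x = y) + c1 * of_bool ((x, y) \<in> B1) + c2 * of_bool ((x, y) \<in> B2)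
        + c3 * of_bool ((x, y) \<in> B3) + c4 * of_bool ((x, y) \<in> B4)"
  shows "adj_op X R (adj_op X S f) x
    = c0 * f x + c1 * A f x + c2 * adj_op X B2 f x + c3 * D f x + c4 * adj_op X B4 f x"
proof -
  have "adj_op X R (adj_op X S f) x = (\<Sum>y\<in>X. (c0 * of_bool (x = y) + c1 * of_bool ((x, y) \<in> B1)
      + c2 * of_bool ((x, y) \<in> B2) + c3 * of_bool ((x, y) \<in> B3) + c4 * of_bool ((x, y) \<in> B4)) * f y)"
    unfolding adj_op_comp[OF finite_X] by (intro sum.cong) (simp_all add: assms(2))
  also have "\<dots> = c0 * (\<Sum>y\<in>X. of_bool (x = y) * f y) + c1 * A f x + c2 * adj_op X B2 f x
      + c3 * D f x + c4 * adj_op X B4 f x"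
    unfolding adj_op_def distrib_right sum.distrib sum_distrib_left mult.assoc ..
  finally show ?thesis unfolding delta_sum[OF x] .
qed

lemma A_A: "x \<in> X \<Longrightarrow> A (A f) x
    = k * f x + (real s - 2) * A f x + real t * adj_op X B2 f x + (real t + 1) * adj_op X B4 f x"
  using op_of_counts[of x B1 B1 k "real s - 2" "real t" 0 "real t + 1" f] B1_B1[of x]
  by (simp add: k_def)

lemma A_D: "x \<in> X \<Longrightarrow> A (D f) x = adj_op X B2 f x"
  using op_of_counts[of x B1 B3 0 0 1 0 0 f] B1_B3[of x] by simp

lemma D_D: "x \<in> X \<Longrightarrow> D (D f) x = (real t - 1) * f x + (real t - 2) * D f x"
  using op_of_counts[of x B3 B3 "real t - 1" 0 0 "real t - 2" 0 f] B3_B3[of x] by simp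

lemma B3_B1:
  assumes "x \<in> X" "y \<in> X"
  shows "real (card {z \<in> X. (x, z) \<in> B3 \<and> (z, y) \<in> B1}) = of_bool ((x, y) \<in> B2)"
proof -
  have "{z \<in> X. (x, z) \<in> B3 \<and> (z, y) \<in> B1} = {z \<in> X. (y, z) \<in> B1 \<and> (z, x) \<in> B3}"
    using sym by (auto dest: symD)
  moreover have "(y, x) \<in> B2 \<longleftrightarrow> (x, y) \<in> B2" using sym by (auto dest: symD)
  ultimately show ?thesis using B1_B3[OF assms(2,1)] by simp
qed

lemma D_A: "x \<in> X \<Longrightarrow> D (A f) x = adj_op X B2 f x"
  using op_of_counts[of x B3 B1 0 0 1 0 0 f] B3_B1[of x] by simp

lemma row_sum:
  assumes x: "x \<in> X" and "sym R"
  shows "(\<Sum>y\<in>X. of_bool ((x, y) \<in> R)) = real (card {z \<in> X. (x, z) \<in> R \<and> (z, x) \<in> R})"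
proof -
  have "{z \<in> X. (x, z) \<in> R \<and> (z, x) \<in> R} = X \<inter> {z. (x, z) \<in> R}"
    using \<open>sym R\<close> by (auto dest: symD)
  then show ?thesis using finite_X by simp
qed

text \<open>
  A symmetric relation of constant valency also has constant column sums.
\<close>
lemma sum_adj_op:
  assumes "sym R" and "\<And>x. x \<in> X \<Longrightarrow> real (card {z \<in> X. (x, z) \<in> R \<and> (z, x) \<in> R}) = d"
  shows "sum (adj_op X R f) X = d * sum f X"
proof -
  have "sum (adj_op X R f) X = (\<Sum>y\<in>X. \<Sum>x\<in>X. of_bool ((x, y) \<in> R) * f y)"
    unfolding adj_op_def by (rule sum.swap)
  also have "\<dots> = (\<Sum>y\<in>X. d * f y)"
  proof (intro sum.cong refl)
    fix y assume y: "y \<in> X"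
    have "(\<Sum>x\<in>X. of_bool ((x, y) \<in> R)) = (\<Sum>x\<in>X. of_bool ((y, x) \<in> R) :: real)"
      using \<open>sym R\<close> by (intro sum.cong) (auto dest: symD)
    then show "(\<Sum>x\<in>X. of_bool ((x, y) \<in> R) * f y) = d * f y"
      using row_sum[OF y \<open>sym R\<close>] assms(2)[OF y] by (simp flip: sum_distrib_right)
  qed
  finally show ?thesis by (simp add: sum_distrib_left)
qed

lemma valency_B1: "x \<in> X \<Longrightarrow> real (card {z \<in> X. (x, z) \<in> B1 \<and> (z, x) \<in> B1}) = k"
  using B1_B1[of x x] diag[of x] by (simp add: k_def)

lemma valency_B3: "x \<in> X \<Longrightarrow> real (card {z \<in> X. (x, z) \<in> B3 \<and> (z, x) \<in> B3}) = real t - 1"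
  using B3_B3[of x x] diag[of x] by simp

lemma sum_A: "sum (A f) X = k * sum f X"
  by (rule sum_adj_op[OF sym(1) valency_B1])

lemma sum_D: "sum (D f) X = (real t - 1) * sum f X"
  by (rule sum_adj_op[OF sym(3) valency_B3])

lemma A_const: "x \<in> X \<Longrightarrow> A (\<lambda>_. c) x = k * c"
  using row_sum[OF _ sym(1)] valency_B1 by (simp add: adj_op_def flip: sum_distrib_right)

lemma D_const: "x \<in> X \<Longrightarrow> D (\<lambda>_. c) x = (real t - 1) * c"
  using row_sum[OF _ sym(3)] valency_B3 by (simp add: adj_op_def flip: sum_distrib_right)

text \<open>
  The valency of \<open>B4\<close> is what the other valencies leave of \<open>card X\<close>, namely \<open>(s - 1) t (s - t)\<close>.
\<close>
lemma B4_empty: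
  assumes "s = t"
  shows "B4 = {}"
proof -
  have "(x, y) \<notin> B4" if xy: "x \<in> X" "y \<in> X" for x y
  proof -
    have "adj_op X B2 (\<lambda>_. 1) x = A (D (\<lambda>_. 1)) x" using A_D xy by simp
    also have "\<dots> = A (\<lambda>_. real t - 1) x"
      by (rule adj_op_cong) (simp add: D_const)
    finally have "adj_op X B4 (\<lambda>_. 1) x = real (card X) - 1 - k - k * (real t - 1) - (real t - 1)"
      using total_op[OF xy(1), of "\<lambda>_. 1"] A_const[OF xy(1)] D_const[OF xy(1)] by simp
    also have "\<dots> = 0"
      unfolding real_card_X k_def unfolding assms by (simp add: algebra_simps power2_eq_square)
    finally have "real (card {y \<in> X. (x, y) \<in> B4}) = 0"
      using finite_X by (simp add: adj_op_def Collect_conj_eq)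
    then show ?thesis using finite_X xy by auto
  qed
  then show ?thesis using sub(4) by auto
qed

definition Rs where "Rs = [Id_on X, B1, B2, B3] @ (if s = t then [] else [B4])"

lemma length_Rs: "length Rs = (if s = t then 4 else 5)"
  by (simp add: Rs_def)

lemma all_less_length_Rs:
  "(\<forall>j<length Rs. Q j (Rs ! j)) \<longleftrightarrow>
    Q 0 (Id_on X) \<and> Q 1 B1 \<and> Q 2 B2 \<and> Q 3 B3 \<and> (s \<noteq> t \<longrightarrow> Q 4 B4)"
proof -
  have "(\<forall>j<4. Q' j) \<longleftrightarrow> Q' 0 \<and> Q' 1 \<and> Q' 2 \<and> Q' 3" for Q' :: "nat \<Rightarrow> bool"
    by (auto simp: eval_nat_numeral less_Suc_eq)
  then show ?thesis
    unfolding length_Rs unfolding Rs_def by (cases "s = t") (simp_all add: all_less_5)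
qed

lemma adj_op_Id: "x \<in> X \<Longrightarrow> adj_op X (Id_on X) f x = f x"
  using delta_sum[of x f] by (simp add: adj_op_def Id_on_iff)

text \<open>
  Since \<open>B\<^sub>2 = B\<^sub>1B\<^sub>3\<close> and the five matrices add up to the all-one matrix \<open>J\<close>, a common eigenvector of
  \<open>B\<^sub>1\<close>, \<open>B\<^sub>3\<close> and \<open>J\<close> is one for the whole scheme.
\<close>
lemma eigenvector_of_A_D:
  assumes A: "\<And>x. x \<in> X \<Longrightarrow> A f x = \<theta> 1 * f x"
    and D: "\<And>x. x \<in> X \<Longrightarrow> D f x = \<theta> 3 * f x"
    and J: "\<And>x. x \<in> X \<Longrightarrow> sum f X = c * f x"
    and \<theta>: "\<theta> 0 = 1" "\<theta> 2 = \<theta> 1 * \<theta> 3" "\<theta> 4 = c - 1 - \<theta> 1 - \<theta> 2 - \<theta> 3"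
  shows "f \<in> common_eigenspace X Rs \<theta>"
proof -
  have B2: "adj_op X B2 f x = \<theta> 2 * f x" if "x \<in> X" for x
  proof -
    have "adj_op X B2 f x = A (D f) x" using A_D that by simp
    also have "\<dots> = A (\<lambda>y. \<theta> 3 * f y) x" by (rule adj_op_cong) (rule D)
    also have "\<dots> = \<theta> 2 * f x" using A[OF that] by (simp add: adj_op_scale \<theta>(2))
    finally show ?thesis .
  qed
  have "adj_op X B4 f x = \<theta> 4 * f x" if "x \<in> X" for x
    using total_op[OF that, of f] A[OF that] D[OF that] B2[OF that] J[OF that]
    by (simp add: \<theta>(3) algebra_simps)
  then show ?thesis
    unfolding common_eigenspace_iff
    using all_less_length_Rs[of "\<lambda>j R. \<forall>x\<in>X. adj_op X R f x = \<theta> j * f x"] A D B2 adj_op_Id \<theta>(1)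
    by simp
qed

text \<open>
  If \<open>A\<close> satisfies \<open>(A - p)(A - q) = 0\<close> on a subspace, this is the projection of \<open>u\<close> to its
  \<open>p\<close>-eigenspace.
\<close>
definition eigen_part where "eigen_part p q u = (\<lambda>x. (A u x - q * u x) / (p - q))"

lemma eigen_part_add_eigen_part: "p \<noteq> q \<Longrightarrow> eigen_part p q u x + eigen_part q p u x = u x"
  unfolding eigen_part_def by (simp add: divide_simps) (simp add: algebra_simps)

lemma eigen_part_linear: "eigen_part p q u = (\<lambda>x. 1 / (p - q) * A u x + (- q / (p - q)) * u x)"
  unfolding eigen_part_def by (auto simp: diff_divide_distrib)

lemma A_eigen_part:
  assumes "p \<noteq> q" "x \<in> X" and AA: "\<And>x. x \<in> X \<Longrightarrow> A (A u) x = (p + q) * A u x - p * q * u x"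
  shows "A (eigen_part p q u) x = p * eigen_part p q u x"
proof -
  have "A (eigen_part p q u) x = 1 / (p - q) * A (A u) x + (- q / (p - q)) * A u x"
    unfolding eigen_part_linear adj_op_linear ..
  with assms show ?thesis unfolding eigen_part_def by (simp add: divide_simps) (simp add: algebra_simps)
qed

lemma D_eigen_part:
  assumes "x \<in> X" and D: "\<And>x. x \<in> X \<Longrightarrow> D u x = b * u x"
  shows "D (eigen_part p q u) x = b * eigen_part p q u x"
proof -
  have "D (A u) x = A (D u) x" using A_D D_A assms(1) by simp
  also have "\<dots> = A (\<lambda>x. b * u x) x" by (rule adj_op_cong) (rule D)
  finally have "D (A u) x = b * A u x" by (simp add: adj_op_scale)
  moreover have "D (eigen_part p q u) x = 1 / (p - q) * D (A u) x + (- q / (p - q)) * D u x"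
    unfolding eigen_part_linear adj_op_linear ..
  ultimately show ?thesis
    using D[OF assms(1)] by (simp add: eigen_part_linear algebra_simps)
qed

lemma sum_eigen_part:
  assumes "sum u X = 0"
  shows "sum (eigen_part p q u) X = 0"
proof -
  have "sum (eigen_part p q u) X = 1 / (p - q) * sum (A u) X + (- q / (p - q)) * sum u X"
    unfolding eigen_part_linear sum.distrib sum_distrib_left ..
  with sum_A[of u] assms show ?thesis by simp
qed

text \<open>
  On vectors with sum zero in an eigenspace of \<open>B\<^sub>3\<close>, the formula for \<open>B\<^sub>1B\<^sub>1\<close> becomes a quadratic
  equation for \<open>B\<^sub>1\<close>, because there \<open>B\<^sub>2\<close> and \<open>B\<^sub>4\<close> are linear expressions in \<open>B\<^sub>1\<close>.
\<close>
lemma A_A_eigen: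
  assumes x: "x \<in> X" and D: "\<And>x. x \<in> X \<Longrightarrow> D u x = b * u x" and J: "sum u X = 0"
  shows "A (A u) x = (k - (real t + 1) * (1 + b)) * u x
    + (real s - 2 + real t * b - (real t + 1) * (1 + b)) * A u x"
proof -
  have "adj_op X B2 u x = A (D u) x" using A_D x by simp
  also have "\<dots> = A (\<lambda>y. b * u y) x" by (rule adj_op_cong) (rule D)
  finally have B2: "adj_op X B2 u x = b * A u x" by (simp add: adj_op_scale)
  have B4: "adj_op X B4 u x = - u x - A u x - b * A u x - b * u x"
    using total_op[OF x, of u] D[OF x] B2 J by simp
  show ?thesis unfolding A_A[OF x] B2 B4 by (simp add: algebra_simps)
qed

lemma eigen_part_eigenvector:
  assumes pq: "p \<noteq> q"
    and AA: "\<And>x. x \<in> X \<Longrightarrow> A (A u) x = (p + q) * A u x - p * q * u x"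
    and D: "\<And>x. x \<in> X \<Longrightarrow> D u x = b * u x" and J: "sum u X = 0"
    and \<theta>: "\<theta> 0 = 1" "\<theta> 1 = p" "\<theta> 2 = p * b" "\<theta> 3 = b" "\<theta> 4 = - 1 - p - p * b - b"
  shows "eigen_part p q u \<in> common_eigenspace X Rs \<theta>"
proof (rule eigenvector_of_A_D[where c = 0])
  show "A (eigen_part p q u) x = \<theta> 1 * eigen_part p q u x" if "x \<in> X" for x
    unfolding \<theta> by (rule A_eigen_part[OF pq that AA])
  show "D (eigen_part p q u) x = \<theta> 3 * eigen_part p q u x" if "x \<in> X" for x
    unfolding \<theta> by (rule D_eigen_part[OF that D])
  show "sum (eigen_part p q u) X = 0 * eigen_part p q u x" for x
    by (simp add: sum_eigen_part[OF J])
qed (simp_all only: \<theta> diff_0)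

text \<open>
  \<open>B\<^sub>3\<close> together with the identity is an equivalence relation with classes of size \<open>t\<close>; this is the
  projection to the functions that are constant on the classes.
\<close>
definition class_avg where "class_avg f = (\<lambda>x. (f x + D f x) / real t)"
definition mean where "mean f = sum f X / real (card X)" for f :: "'a \<Rightarrow> real"
definition class_deviation where "class_deviation f = (\<lambda>x. f x - class_avg f x)"
definition centred_class_avg where "centred_class_avg f = (\<lambda>x. class_avg f x - mean f)"

lemma class_avg_linear: "class_avg f = (\<lambda>x. 1 / real t * f x + 1 / real t * D f x)"
  by (simp add: class_avg_def add_divide_distrib)

lemma adj_op_diff: "adj_op X R (\<lambda>y. f y - g y) x = adj_op X R f x - adj_op X R g x"
  using adj_op_linear[of X R 1 f "-1" g x] by simp

lemma D_class_avg: "x \<in> X \<Longrightarrow> D (class_avg f) x = (real t - 1) * class_avg f x"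
  using st_real unfolding class_avg_linear adj_op_linear
  by (simp add: D_D divide_simps) (simp add: algebra_simps)

lemma D_class_deviation: "x \<in> X \<Longrightarrow> D (class_deviation f) x = - 1 * class_deviation f x"
proof -
  assume x: "x \<in> X"
  have "D f x = real t * class_avg f x - f x" using st_real by (simp add: class_avg_def)
  then show "D (class_deviation f) x = - 1 * class_deviation f x"
    unfolding class_deviation_def adj_op_diff D_class_avg[OF x] by (simp add: algebra_simps)
qed

lemma D_centred_class_avg: "x \<in> X \<Longrightarrow> D (centred_class_avg f) x = (real t - 1) * centred_class_avg f x"
  unfolding centred_class_avg_def adj_op_diff by (simp add: D_class_avg D_const algebra_simps)

lemma sum_class_avg: "sum (class_avg f) X = sum f X"
  unfolding class_avg_linear sum.distrib sum_distrib_left[symmetric] sum_D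
  using st_real by (simp add: divide_simps) (simp add: algebra_simps)

lemma sum_class_deviation: "sum (class_deviation f) X = 0"
  by (simp add: class_deviation_def sum_subtractf sum_class_avg)

lemma X_nonempty: "X \<noteq> {}"
  using card_X t_ge_2 t_le_s by auto

lemma sum_centred_class_avg: "sum (centred_class_avg f) X = 0"
  using X_nonempty finite_X by (simp add: centred_class_avg_def sum_subtractf sum_class_avg mean_def)

lemma A_A_class_deviation: "x \<in> X \<Longrightarrow> A (A (class_deviation f)) x
    = ((real s - 1) + (- real t - 1)) * A (class_deviation f) x - (real s - 1) * (- real t - 1) * class_deviation f x"
  by (subst A_A_eigen[OF _ D_class_deviation sum_class_deviation]) (simp_all add: k_def algebra_simps)

lemma A_A_centred_class_avg: "x \<in> X \<Longrightarrow> A (A (centred_class_avg f)) x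
    = ((real s - real t - 1) + (- real t - 1)) * A (centred_class_avg f) x
      - (real s - real t - 1) * (- real t - 1) * centred_class_avg f x"
  by (subst A_A_eigen[OF _ D_centred_class_avg sum_centred_class_avg]) (simp_all add: k_def algebra_simps)

text \<open>
  The projections of \<open>f\<close> to the five common eigenspaces, in the order of the rows of \<open>P\<close>. The
  eigenvalues of \<open>B\<^sub>1\<close> are \<open>s - 1\<close> and \<open>-t - 1\<close> on vectors with sum zero on every class, and
  \<open>s - t - 1\<close> and \<open>-t - 1\<close> on vectors with sum zero that are constant on the classes.
\<close>
definition component where
  "component f = (!) [\<lambda>_. mean f,
     eigen_part (real s - 1) (- real t - 1) (class_deviation f), eigen_part (real s - real t - 1) (- real t - 1) (centred_class_avg f),
     eigen_part (- real t - 1) (real s - 1) (class_deviation f), eigen_part (- real t - 1) (real s - real t - 1) (centred_class_avg f)]"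

lemma component_eigenvector:
  assumes "i < 5"
  shows "component f i \<in> common_eigenspace X Rs (regP s t i)"
proof -
  have ne: "real s - 1 \<noteq> - real t - 1" "real s - real t - 1 \<noteq> - real t - 1"
    using st_real by auto
  note ne' = not_sym[OF ne(1)] not_sym[OF ne(2)]
  have AAu: "\<And>x. x \<in> X \<Longrightarrow> A (A (class_deviation f)) x
    = ((- real t - 1) + (real s - 1)) * A (class_deviation f) x - (- real t - 1) * (real s - 1) * class_deviation f x"
    by (simp add: A_A_class_deviation algebra_simps)
  have AAw: "\<And>x. x \<in> X \<Longrightarrow> A (A (centred_class_avg f)) x
    = ((- real t - 1) + (real s - real t - 1)) * A (centred_class_avg f) x
      - (- real t - 1) * (real s - real t - 1) * centred_class_avg f x"
    by (simp add: A_A_centred_class_avg algebra_simps)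
  have 0: "(\<lambda>_. mean f) \<in> common_eigenspace X Rs (regP s t 0)"
    by (rule eigenvector_of_A_D[where c = "real (card X)"])
      (simp_all add: regP_simps A_const D_const k_def card_X algebra_simps power2_eq_square)
  have 1: "eigen_part (real s - 1) (- real t - 1) (class_deviation f) \<in> common_eigenspace X Rs (regP s t 1)"
    by (rule eigen_part_eigenvector[OF ne(1) A_A_class_deviation D_class_deviation sum_class_deviation])
      (simp_all add: regP_simps algebra_simps power2_eq_square)
  have 2: "eigen_part (real s - real t - 1) (- real t - 1) (centred_class_avg f) \<in> common_eigenspace X Rs (regP s t 2)"
    by (rule eigen_part_eigenvector[OF ne(2) A_A_centred_class_avg D_centred_class_avg sum_centred_class_avg])
      (simp_all add: regP_simps algebra_simps power2_eq_square)
  have 3: "eigen_part (- real t - 1) (real s - 1) (class_deviation f) \<in> common_eigenspace X Rs (regP s t 3)"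
    by (rule eigen_part_eigenvector[OF ne'(1) AAu D_class_deviation sum_class_deviation])
      (simp_all add: regP_simps algebra_simps power2_eq_square)
  have 4: "eigen_part (- real t - 1) (real s - real t - 1) (centred_class_avg f) \<in> common_eigenspace X Rs (regP s t 4)"
    by (rule eigen_part_eigenvector[OF ne'(2) AAw D_centred_class_avg sum_centred_class_avg])
      (simp_all add: regP_simps algebra_simps power2_eq_square)
  from assms have "i = 0 \<or> i = 1 \<or> i = 2 \<or> i = 3 \<or> i = 4" by linarith
  then show ?thesis
    by (elim disjE) (use 0 1 2 3 4 in \<open>simp_all add: component_def\<close>)
qed

lemma sum_components: "(\<Sum>i<5. component f i x) = f x"
proof -
  have ne: "real s - 1 \<noteq> - real t - 1" "real s - real t - 1 \<noteq> - real t - 1"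
    using st_real by auto
  have "(\<Sum>i<5. component f i x) = mean f + class_deviation f x + centred_class_avg f x"
    using eigen_part_add_eigen_part[OF ne(1), of "class_deviation f" x] eigen_part_add_eigen_part[OF ne(2), of "centred_class_avg f" x]
    by (simp add: sum_less_5 component_def)
  then show ?thesis by (simp add: class_deviation_def centred_class_avg_def)
qed

text \<open>
  For \<open>s = t\<close> the vanishing of \<open>B4\<close> gives a linear equation for \<open>B\<^sub>1\<close> on the vectors that are constant
  on classes, which leaves only the eigenvalue \<open>s - t - 1 = -1\<close>.
\<close>
lemma component_4_zero:
  assumes "s = t" "x \<in> X"
  shows "component f 4 x = 0"
proof -
  have "adj_op X B2 (centred_class_avg f) x = A (D (centred_class_avg f)) x" using A_D assms by simp
  also have "\<dots> = A (\<lambda>y. (real t - 1) * centred_class_avg f y) x" by (rule adj_op_cong) (rule D_centred_class_avg)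
  finally have "adj_op X B2 (centred_class_avg f) x = (real t - 1) * A (centred_class_avg f) x" by (simp add: adj_op_scale)
  moreover have "adj_op X B4 (centred_class_avg f) x = 0" using B4_empty assms(1) by (simp add: adj_op_def)
  ultimately have "real t * (A (centred_class_avg f) x + centred_class_avg f x) = 0"
    using total_op[OF assms(2), of "centred_class_avg f"] D_centred_class_avg[OF assms(2), of f] sum_centred_class_avg[of f]
    by (simp add: algebra_simps)
  then have "A (centred_class_avg f) x = - centred_class_avg f x" using st_real by simp
  moreover have "real s - real t - 1 = - 1" using assms(1) by simp
  ultimately show ?thesis unfolding component_def eigen_part_def by simp
qed

text \<open>
  Every common eigenspace is nonzero: the value at \<open>x\<close> of the projection of the unit vector at \<open>x\<close>
  is the diagonal entry of an idempotent, and these entries can be computed.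
\<close>
lemma component_delta_pos:
  assumes x: "x \<in> X" and i: "i < length Rs"
  shows "component (\<lambda>y. of_bool (y = x)) i x > 0"
proof -
  let ?d = "\<lambda>y. of_bool (y = x) :: real"
  have delta: "adj_op X R ?d x = of_bool ((x, x) \<in> R)" for R
    using finite_X x by (rule adj_op_delta)
  have sum_d: "sum ?d X = 1" using sum_times_delta[OF finite_X x, of "\<lambda>_. 1"] by simp
  have A: "A ?d x = 0" and D: "D ?d x = 0" and AD: "A (D ?d) x = 0"
    using diag[OF x] A_D[OF x] by (simp_all add: delta)
  have m: "mean ?d = 1 / (real s ^ 2 * real t)" by (simp add: mean_def sum_d card_X)
  have Ae: "A (class_avg ?d) x = 0" unfolding class_avg_linear adj_op_linear by (simp add: A AD)
  have e: "class_avg ?d x = 1 / real t" by (simp add: class_avg_def D)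
  have u: "class_deviation ?d x = (real t - 1) / real t"
    using st_real unfolding class_deviation_def e by (simp add: divide_simps)
  have Au: "A (class_deviation ?d) x = 0" unfolding class_deviation_def adj_op_diff A Ae by simp
  have w: "centred_class_avg ?d x = (real s ^ 2 - 1) / (real s ^ 2 * real t)"
    using st_real unfolding centred_class_avg_def e m by (simp add: divide_simps) (simp add: algebra_simps power2_eq_square)?
  have Aw: "A (centred_class_avg ?d) x = - k / (real s ^ 2 * real t)"
    unfolding centred_class_avg_def adj_op_diff Ae A_const[OF x] m by simp
  have "i < 5" using i by (simp add: length_Rs split: if_splits)
  then have "i = 0 \<or> i = 1 \<or> i = 2 \<or> i = 3 \<or> i = 4" by linarith
  then show ?thesis
  proof (elim disjE)
    assume "i = 0" then show ?thesis using st_real by (simp add: component_def m)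
  next
    assume "i = 1"
    have "A (class_deviation ?d) x - (- real t - 1) * class_deviation ?d x = (real t + 1) * ((real t - 1) / real t)"
    proof -
      have "0 - (- a - 1) * c = (a + 1) * c" for a c :: real by (simp add: algebra_simps)
      then show ?thesis unfolding u Au .
    qed
    also have "\<dots> > 0" using st_real by simp
    finally show ?thesis using \<open>i = 1\<close> st_real by (simp add: component_def eigen_part_def)
  next
    assume "i = 2"
    have "A (centred_class_avg ?d) x - (- real t - 1) * centred_class_avg ?d x
        = (real t + 1) * (real s * (real s - 1)) / (real s ^ 2 * real t)"
      using st_real unfolding Aw w k_def by (simp add: divide_simps) (simp add: algebra_simps power2_eq_square)
    also have "\<dots> > 0" using st_real by simp
    finally show ?thesis using \<open>i = 2\<close> st_real by (simp add: component_def eigen_part_def)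
  next
    assume "i = 3"
    have "A (class_deviation ?d) x - (real s - 1) * class_deviation ?d x = - ((real s - 1) * ((real t - 1) / real t))"
      unfolding u Au by simp
    also have "\<dots> < 0" using st_real by simp
    finally show ?thesis
      using divide_neg_neg[of _ "(- real t - 1) - (real s - 1)"] st_real
      unfolding \<open>i = 3\<close> component_def eigen_part_def by simp
  next
    assume "i = 4"
    then have "s > t" using i t_le_s by (simp add: length_Rs split: if_splits)
    then have "real s - real t - 1 \<ge> 0" by simp
    have "A (centred_class_avg ?d) x - (real s - real t - 1) * centred_class_avg ?d x
        = - ((real s - real t - 1) * real s ^ 2 + real s * real t) / (real s ^ 2 * real t)"
      using st_real unfolding Aw w k_def by (simp add: divide_simps) (simp add: algebra_simps power2_eq_square)
    also have "\<dots> < 0"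
    proof (rule divide_neg_pos)
      have "(real s - real t - 1) * real s ^ 2 \<ge> 0" "real s * real t > 0"
        using st_real \<open>real s - real t - 1 \<ge> 0\<close> by simp_all
      then show "- ((real s - real t - 1) * real s ^ 2 + real s * real t) < 0" by linarith
    qed (use st_real in simp)
    finally show ?thesis
      using divide_neg_neg[of _ "(- real t - 1) - (real s - real t - 1)"] st_real
      unfolding \<open>i = 4\<close> component_def eigen_part_def by simp
  qed
qed

lemma regP_rows_distinct:
  assumes "i < 5" "l < 5" "i \<noteq> l"
  shows "regP s t i 1 \<noteq> regP s t l 1 \<or> regP s t i 3 \<noteq> regP s t l 3"
proof -
  have "k = (real s - real t - 1) + real s * real t"
    by (simp add: k_def algebra_simps)
  then have k: "k > real s - real t - 1" using st_real by simp
  have "i = 0 \<or> i = 1 \<or> i = 2 \<or> i = 3 \<or> i = 4" "l = 0 \<or> l = 1 \<or> l = 2 \<or> l = 3 \<or> l = 4"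
    using assms by linarith+
  then show ?thesis
    using assms(3) st_real k by (elim disjE) (simp_all add: regP_simps flip: k_def)
qed

lemma first_eigenmatrix_Rs: "first_eigenmatrix X Rs (regP s t)"
  unfolding first_eigenmatrix_def
proof (intro conjI allI impI)
  have le: "length Rs \<le> 5" "4 \<le> length Rs" by (simp_all add: length_Rs)
  obtain x where x: "x \<in> X" using X_nonempty by blast
  show "\<exists>f\<in>common_eigenspace X Rs (regP s t i). \<exists>x\<in>X. f x \<noteq> 0" if "i < length Rs" for i
  proof (rule bexI[of _ "component (\<lambda>y. of_bool (y = x)) i"], rule bexI[of _ x])
    show "component (\<lambda>y. of_bool (y = x)) i x \<noteq> 0"
      using component_delta_pos[OF x that] by simp
    show "component (\<lambda>y. of_bool (y = x)) i \<in> common_eigenspace X Rs (regP s t i)"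
      using le that by (intro component_eigenvector) simp
  qed (rule x)
  show "\<exists>j<length Rs. regP s t i j \<noteq> regP s t l j" if "i < length Rs" "l < length Rs" "i \<noteq> l" for i l
  proof -
    have "1 < length Rs" "3 < length Rs" using le by linarith+
    moreover have "regP s t i 1 \<noteq> regP s t l 1 \<or> regP s t i 3 \<noteq> regP s t l 3"
      using that le by (intro regP_rows_distinct) linarith+
    ultimately show ?thesis by blast
  qed
  show "\<exists>g. (\<forall>i<length Rs. g i \<in> common_eigenspace X Rs (regP s t i)) \<and>
      (\<forall>x\<in>X. f x = (\<Sum>i<length Rs. g i x))" for f
  proof (intro exI[of _ "component f"] conjI allI impI ballI)
    show "component f i \<in> common_eigenspace X Rs (regP s t i)" if "i < length Rs" for i
      using that le by (intro component_eigenvector) simp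
    show "f x = (\<Sum>i<length Rs. component f i x)" if "x \<in> X" for x
    proof (cases "s = t")
      case True
      then have "length Rs = 4" using length_Rs by simp
      moreover have "(\<Sum>i<5. g i) = (\<Sum>i<4. g i) + g 4" for g :: "nat \<Rightarrow> real"
        by (simp add: eval_nat_numeral)
      ultimately show ?thesis
        using component_4_zero[OF True that, of f] sum_components[of f x] by simp
    qed (simp add: length_Rs sum_components)
  qed
qed

end

section \<open>The scheme generated by the first relation\<close>

lemma scheme_of_relation_unique:
  assumes "association_scheme X \<R>" "S \<in> \<R>" "T \<in> \<R>" "p \<in> S" "p \<in> T"
  shows "S = T"
  using assms unfolding association_scheme_def partition_on_def disjoint_def by blast

text \<open>
  In any scheme that contains \<open>E\<close>, the square of the matrix of \<open>E\<close> is a linear combination of the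
  adjacency matrices.
\<close>
lemma scheme_path_count_constant:
  assumes scheme: "association_scheme X \<R>" and E: "scheme_contains \<R> E"
    and T: "T \<in> \<R>" "(x, y) \<in> T" "(x', y') \<in> T"
  shows "card {z \<in> X. (x, z) \<in> E \<and> (z, y) \<in> E} = card {z \<in> X. (x', z) \<in> E \<and> (z, y') \<in> E}"
proof -
  obtain \<S> where \<S>: "\<S> \<subseteq> \<R>" "E = \<Union>\<S>"
    using E by (auto simp: scheme_contains_def)
  have finX: "finite X" and part: "partition_on (X \<times> X) \<R>"
    using scheme by (auto simp: association_scheme_def)
  then have "finite \<S>"
    using \<S>(1) by (meson finite_SigmaI finite_elements finite_subset)
  have count: "card {z \<in> X. (a, z) \<in> E \<and> (z, b) \<in> E}
      = (\<Sum>(R, S)\<in>\<S> \<times> \<S>. card {z \<in> X. (a, z) \<in> R \<and> (z, b) \<in> S})" for a b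
  proof -
    have "{z \<in> X. (a, z) \<in> E \<and> (z, b) \<in> E}
        = (\<Union>p\<in>\<S> \<times> \<S>. {z \<in> X. (a, z) \<in> fst p \<and> (z, b) \<in> snd p})"
      unfolding \<S>(2) by auto
    also have "card \<dots> = (\<Sum>p\<in>\<S> \<times> \<S>. card {z \<in> X. (a, z) \<in> fst p \<and> (z, b) \<in> snd p})"
    proof (rule card_UN_disjoint)
      show "\<forall>p\<in>\<S> \<times> \<S>. \<forall>q\<in>\<S> \<times> \<S>. p \<noteq> q \<longrightarrow> {z \<in> X. (a, z) \<in> fst p \<and> (z, b) \<in> snd p}
          \<inter> {z \<in> X. (a, z) \<in> fst q \<and> (z, b) \<in> snd q} = {}"
      proof (intro ballI impI equals0I)
        fix p q z
        assume pq: "p \<in> \<S> \<times> \<S>" "q \<in> \<S> \<times> \<S>" "p \<noteq> q"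
          and z: "z \<in> {z \<in> X. (a, z) \<in> fst p \<and> (z, b) \<in> snd p}
            \<inter> {z \<in> X. (a, z) \<in> fst q \<and> (z, b) \<in> snd q}"
        have "fst p \<in> \<R>" "fst q \<in> \<R>" "snd p \<in> \<R>" "snd q \<in> \<R>"
          using pq(1,2) \<S>(1) by auto
        then have "fst p = fst q" "snd p = snd q"
          using scheme_of_relation_unique[OF scheme] z by blast+
        with pq(3) show False by (simp add: prod_eq_iff)
      qed
      show "finite (\<S> \<times> \<S>)" using \<open>finite \<S>\<close> by simp
      show "\<forall>p\<in>\<S> \<times> \<S>. finite {z \<in> X. (a, z) \<in> fst p \<and> (z, b) \<in> snd p}"
        using finX by simp
    qed
    finally show ?thesis by (simp add: case_prod_beta)
  qed
  have "card {z \<in> X. (x, z) \<in> R \<and> (z, y) \<in> S} = card {z \<in> X. (x', z) \<in> R \<and> (z, y') \<in> S}"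
    if RS: "R \<in> \<S>" "S \<in> \<S>" for R S
  proof -
    have "\<exists>p. \<forall>(x, y)\<in>T. card {z \<in> X. (x, z) \<in> R \<and> (z, y) \<in> S} = p"
      using scheme RS \<S>(1) T(1) unfolding association_scheme_def by blast
    then obtain p where p: "\<forall>(x, y)\<in>T. card {z \<in> X. (x, z) \<in> R \<and> (z, y) \<in> S} = p" ..
    show ?thesis using bspec[OF p T(2)] bspec[OF p T(3)] by simp
  qed
  then show ?thesis unfolding count by (intro sum.cong) auto
qed

lemma scheme_contains_relation:
  assumes "association_scheme X \<R>" "T \<in> \<R>" "scheme_contains \<R> E" "p \<in> T" "q \<in> T" "p \<in> E"
  shows "q \<in> E"
proof -
  obtain \<S> where \<S>: "\<S> \<subseteq> \<R>" "E = \<Union>\<S>"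
    using assms(3) by (auto simp: scheme_contains_def)
  then obtain S where S: "S \<in> \<S>" "p \<in> S" using assms(6) by blast
  then have "S = T"
    using scheme_of_relation_unique[OF assms(1)] \<S>(1) assms(2,4) by blast
  with S \<S>(2) assms(5) show ?thesis by blast
qed

text \<open>
  A union of relations of a scheme is the same as a relation that no member of the scheme cuts.
\<close>
lemma scheme_containsI:
  assumes "association_scheme X \<R>" "Q \<subseteq> X \<times> X"
    and "\<And>T p q. T \<in> \<R> \<Longrightarrow> p \<in> T \<Longrightarrow> q \<in> T \<Longrightarrow> p \<in> Q \<Longrightarrow> q \<in> Q"
  shows "scheme_contains \<R> Q"
proof -
  have "\<Union>\<R> = X \<times> X"
    using assms(1) by (auto simp: association_scheme_def partition_on_def)
  then have Q: "Q = \<Union>{T \<in> \<R>. T \<subseteq> Q}"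
    using assms(2,3) by blast
  show ?thesis
    unfolding scheme_contains_def by (rule exI, rule conjI[rotated], rule Q) auto
qed

context regular_multiplication_table
begin

lemma sum_of_bool_Rs:
  assumes "x \<in> X" "y \<in> X"
  shows "(\<Sum>j<length Rs. of_bool ((x, y) \<in> Rs ! j)) = (1::real)"
proof -
  have "(\<Sum>j<length Rs. of_bool ((x, y) \<in> Rs ! j)) = of_bool (x = y) + of_bool ((x, y) \<in> B1)
    + of_bool ((x, y) \<in> B2) + of_bool ((x, y) \<in> B3) + (of_bool ((x, y) \<in> B4) :: real)"
  proof (cases "s = t")
    case True
    then show ?thesis
      unfolding Rs_def using B4_empty assms by (simp add: eval_nat_numeral Id_on_iff)
  next
    case False
    then show ?thesis
      unfolding Rs_def using assms by (simp add: eval_nat_numeral Id_on_iff)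
  qed
  then show ?thesis using exactly_one[OF assms] by simp
qed

lemma Rs_subset: "j < length Rs \<Longrightarrow> Rs ! j \<subseteq> X \<times> X"
  using all_less_length_Rs[of "\<lambda>j R. R \<subseteq> X \<times> X"] sub by auto

lemma Rs_sym: "j < length Rs \<Longrightarrow> sym (Rs ! j)"
  using all_less_length_Rs[of "\<lambda>j R. sym R"] sym by (auto simp: sym_Id_on)

lemma Rs_index_unique:
  assumes "i < length Rs" "j < length Rs" "p \<in> Rs ! i" "p \<in> Rs ! j"
  shows "i = j"
proof (rule ccontr)
  assume "i \<noteq> j"
  obtain x y where p: "p = (x, y)" by (cases p)
  then have xy: "x \<in> X" "y \<in> X" using Rs_subset assms by blast+
  have "(\<Sum>l\<in>{i, j}. of_bool ((x, y) \<in> Rs ! l) :: real) \<le> (\<Sum>l<length Rs. of_bool ((x, y) \<in> Rs ! l))"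
    using assms by (intro sum_mono2) auto
  with sum_of_bool_Rs[OF xy] \<open>i \<noteq> j\<close> assms p show False by simp
qed

lemma Rs_cover:
  assumes "x \<in> X" "y \<in> X"
  shows "\<exists>j<length Rs. (x, y) \<in> Rs ! j"
proof (rule ccontr)
  assume "\<not> ?thesis"
  then have "(\<Sum>j<length Rs. of_bool ((x, y) \<in> Rs ! j)) = (0::real)" by simp
  with sum_of_bool_Rs[OF assms] show False by simp
qed

text \<open>
  The constant vector is an eigenvector for the first row, so this row lists the valencies, and they
  are positive.
\<close>
lemma Rs_nonempty:
  assumes "j < length Rs"
  shows "Rs ! j \<noteq> {}"
proof
  assume empty: "Rs ! j = {}"
  obtain x where x: "x \<in> X" using X_nonempty by blast
  have "mean (\<lambda>_. 1) = 1"
    using X_nonempty finite_X by (simp add: mean_def)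
  then have "(\<lambda>_. 1) \<in> common_eigenspace X Rs (regP s t 0)"
    using component_eigenvector[of 0 "\<lambda>_. 1"] by (simp add: component_def)
  then have "adj_op X (Rs ! j) (\<lambda>_. 1) x = regP s t 0 j * 1"
    unfolding common_eigenspace_iff using assms x by blast
  then have "regP s t 0 j = 0" unfolding empty by (simp add: adj_op_def)
  moreover have "1 < real t ^ 2" using st_real by (intro one_less_power) auto
  then have "\<forall>j<length Rs. regP s t 0 j > 0"
    unfolding all_less_length_Rs[of "\<lambda>j R. regP s t 0 j > 0"]
    using st_real by (auto simp: regP_simps intro!: mult_pos_pos)
  ultimately show False using assms by fastforce
qed

lemma distinct_Rs: "distinct Rs"
  unfolding distinct_conv_nth using Rs_nonempty Rs_index_unique by (metis all_not_in_conv)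

text \<open>
  The intersection numbers exist because the span of the columns of the eigenmatrix is closed under
  entrywise products.
\<close>
lemma symmetric_association_scheme_Rs: "symmetric_association_scheme X (set Rs)"
  unfolding symmetric_association_scheme_def association_scheme_def
proof (intro conjI)
  show "partition_on (X \<times> X) (set Rs)"
    unfolding partition_on_def
  proof (intro conjI)
    show "\<Union> (set Rs) = X \<times> X"
    proof
      show "\<Union> (set Rs) \<subseteq> X \<times> X" using Rs_subset by (fastforce simp: in_set_conv_nth)
      show "X \<times> X \<subseteq> \<Union> (set Rs)"
      proof (rule subsetI)
        fix p assume "p \<in> X \<times> X"
        then obtain j where "j < length Rs" "p \<in> Rs ! j"
          using Rs_cover by (cases p) blast
        then show "p \<in> \<Union> (set Rs)" using nth_mem by blast
      qed
    qed
    show "disjoint (set Rs)"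
      unfolding disjoint_def
    proof (intro ballI impI equals0I)
      fix R S p assume "R \<in> set Rs" "S \<in> set Rs" "R \<noteq> S" "p \<in> R \<inter> S"
      then obtain i j where "i < length Rs" "R = Rs ! i" "j < length Rs" "S = Rs ! j"
        by (metis in_set_conv_nth)
      with Rs_index_unique[of i j p] \<open>R \<noteq> S\<close> \<open>p \<in> R \<inter> S\<close> show False by auto
    qed
    show "{} \<notin> set Rs" using Rs_nonempty by (auto simp: in_set_conv_nth)
  qed
  show "\<forall>R\<in>set Rs. R\<inverse> \<in> set Rs"
    using Rs_sym by (metis in_set_conv_nth sym_conv_converse_eq)
  show "\<forall>R\<in>set Rs. sym R"
    using Rs_sym by (auto simp: in_set_conv_nth)
  show "\<forall>R\<in>set Rs. \<forall>S\<in>set Rs. \<forall>T\<in>set Rs.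
      \<exists>p. \<forall>(x, y)\<in>T. card {z \<in> X. (x, z) \<in> R \<and> (z, y) \<in> S} = p"
  proof (intro ballI)
    fix R S T assume "R \<in> set Rs" "S \<in> set Rs" "T \<in> set Rs"
    then obtain a b l where abl: "a < length Rs" "b < length Rs" "l < length Rs"
      and RST: "R = Rs ! a" "S = Rs ! b" "T = Rs ! l" by (metis in_set_conv_nth)
    obtain c where c: "\<forall>i<length Rs. regP s t i a * regP s t i b = (\<Sum>j<length Rs. c j * regP s t i j)"
      using regP_products[OF abl(1,2) length_Rs] by blast
    have "card {z \<in> X. (x, z) \<in> R \<and> (z, y) \<in> S} = nat \<lfloor>c l\<rfloor>" if "(x, y) \<in> T" for x y
    proof -
      have xy: "x \<in> X" "y \<in> X" using that Rs_subset[OF abl(3)] RST by auto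
      have "real (card {z \<in> X. (x, z) \<in> R \<and> (z, y) \<in> S})
          = (\<Sum>j<length Rs. c j * of_bool ((x, y) \<in> Rs ! j))"
        unfolding RST
        by (rule intersection_numbers_from_eigenmatrix[OF first_eigenmatrix_Rs finite_X abl(1,2) _ xy])
          (use c in blast)
      also have "\<dots> = (\<Sum>j<length Rs. c j * of_bool (j = l))"
      proof (intro sum.cong refl)
        fix j assume "j \<in> {..<length Rs}"
        then have "(x, y) \<in> Rs ! j \<longleftrightarrow> j = l"
          using that RST(3) abl(3) Rs_index_unique by auto
        then show "c j * of_bool ((x, y) \<in> Rs ! j) = c j * of_bool (j = l)" by simp
      qed
      also have "\<dots> = c l" using abl(3) by (intro sum_times_delta) auto
      finally show ?thesis by linarith
    qed
    then show "\<exists>p. \<forall>(x, y)\<in>T. card {z \<in> X. (x, z) \<in> R \<and> (z, y) \<in> S} = p" by blast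
  qed
  show "Id_on X \<in> set Rs" by (simp add: Rs_def)
qed (use finite_X X_nonempty in auto)

text \<open>
  Outside the identity and \<open>B1\<close>, the number of paths of length two in \<open>B1\<close> is \<open>t\<close>, \<open>0\<close> or \<open>t + 1\<close> on
  \<open>B2\<close>, \<open>B3\<close> and \<open>B4\<close>.
\<close>
lemma relation_determined_by_B1_B1:
  assumes "x \<in> X" "y \<in> X" "x' \<in> X" "y' \<in> X"
    and "x = y \<longleftrightarrow> x' = y'" "(x, y) \<in> B1 \<longleftrightarrow> (x', y') \<in> B1"
    and "card {z \<in> X. (x, z) \<in> B1 \<and> (z, y) \<in> B1} = card {z \<in> X. (x', z) \<in> B1 \<and> (z, y') \<in> B1}"
  shows "((x, y) \<in> B2 \<longleftrightarrow> (x', y') \<in> B2) \<and> ((x, y) \<in> B3 \<longleftrightarrow> (x', y') \<in> B3)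
    \<and> ((x, y) \<in> B4 \<longleftrightarrow> (x', y') \<in> B4)"
proof -
  have "(real s - 1) * (real t + 1) * of_bool (x = y) + (real s - 2) * of_bool ((x, y) \<in> B1)
      + real t * of_bool ((x, y) \<in> B2) + (real t + 1) * of_bool ((x, y) \<in> B4)
    = (real s - 1) * (real t + 1) * of_bool (x' = y') + (real s - 2) * of_bool ((x', y') \<in> B1)
      + real t * of_bool ((x', y') \<in> B2) + (real t + 1) * of_bool ((x', y') \<in> B4)"
    using B1_B1[OF assms(1,2)] B1_B1[OF assms(3,4)] assms(7) by simp
  then have *: "real t * of_bool ((x, y) \<in> B2) + (real t + 1) * of_bool ((x, y) \<in> B4)
      = real t * of_bool ((x', y') \<in> B2) + (real t + 1) * of_bool ((x', y') \<in> B4)"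
    unfolding assms(5,6) by simp
  have B2: "(x, y) \<in> B2 \<longleftrightarrow> (x', y') \<in> B2"
    using * st_real by (cases "(x, y) \<in> B2"; cases "(x, y) \<in> B4"; cases "(x', y') \<in> B2"; cases "(x', y') \<in> B4"; simp)
  have B4: "(x, y) \<in> B4 \<longleftrightarrow> (x', y') \<in> B4"
    using * st_real unfolding B2 by (cases "(x, y) \<in> B4"; cases "(x', y') \<in> B4"; simp)
  have "of_bool ((x, y) \<in> B3) = (of_bool ((x', y') \<in> B3) :: real)"
    using exactly_one[OF assms(1,2)] exactly_one[OF assms(3,4)] unfolding B2 B4 assms(5,6) by linarith
  then have "(x, y) \<in> B3 \<longleftrightarrow> (x', y') \<in> B3" by (simp only: of_bool_eq_iff)
  with B2 B4 show ?thesis by blast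
qed

text \<open>
  Within a relation of any scheme containing \<open>B1\<close>, the pairs agree on equality, on membership in \<open>B1\<close>
  and on the number of paths of length two, so that no relation of \<open>Rs\<close> is cut.
\<close>
lemma generates_scheme_Rs:
  assumes "verts H = X" "arcs_ends H = B1"
  shows "generates_scheme H (set Rs)"
  unfolding generates_scheme_def assms
proof (intro conjI allI impI ballI)
  show "association_scheme X (set Rs)"
    using symmetric_association_scheme_Rs by (simp add: symmetric_association_scheme_def)
  have "B1 \<in> set Rs" by (simp add: Rs_def)
  then show "scheme_contains (set Rs) B1"
    unfolding scheme_contains_def by (intro exI[of _ "{B1}"]) auto
  fix \<R> R assume "association_scheme X \<R> \<and> scheme_contains \<R> B1" and R: "R \<in> set Rs"
  then have scheme: "association_scheme X \<R>" and B1: "scheme_contains \<R> B1" by auto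
  have Id: "scheme_contains \<R> (Id_on X)"
    using scheme unfolding association_scheme_def scheme_contains_def
    by (intro exI[of _ "{Id_on X}"]) auto
  have subX: "T \<subseteq> X \<times> X" if "T \<in> \<R>" for T
    using scheme that by (auto simp: association_scheme_def partition_on_def)
  have "scheme_contains \<R> B2 \<and> scheme_contains \<R> B3 \<and> scheme_contains \<R> B4"
  proof -
    have same: "(p \<in> B2 \<longleftrightarrow> q \<in> B2) \<and> (p \<in> B3 \<longleftrightarrow> q \<in> B3) \<and> (p \<in> B4 \<longleftrightarrow> q \<in> B4)"
      if T: "T \<in> \<R>" and pq: "p \<in> T" "q \<in> T" for T p q
    proof -
      obtain x y x' y' where p: "p = (x, y)" and q: "q = (x', y')" by (cases p, cases q)
      have X: "x \<in> X" "y \<in> X" "x' \<in> X" "y' \<in> X" using subX[OF T] pq p q by auto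
      have *: "x = y \<longleftrightarrow> x' = y'"
        using scheme_contains_relation[OF scheme T Id] pq X unfolding p q Id_on_iff by blast
      show ?thesis unfolding p q
      proof (rule relation_determined_by_B1_B1[OF X *])
        show "(x, y) \<in> B1 \<longleftrightarrow> (x', y') \<in> B1"
          using scheme_contains_relation[OF scheme T B1] pq unfolding p q by blast
        show "card {z \<in> X. (x, z) \<in> B1 \<and> (z, y) \<in> B1} = card {z \<in> X. (x', z) \<in> B1 \<and> (z, y') \<in> B1}"
          using scheme_path_count_constant[OF scheme B1 T] pq unfolding p q by blast
      qed
    qed
    show ?thesis
      using scheme_containsI[OF scheme sub(2)] scheme_containsI[OF scheme sub(3)]
        scheme_containsI[OF scheme sub(4)] same by blast
  qed
  with B1 Id R show "scheme_contains \<R> R"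
    by (auto simp: Rs_def split: if_splits)
qed

end

section \<open>The multiplication table of a regular eigenmatrix\<close>

lemma of_bool_sum_relations:
  assumes part: "partition_on (X \<times> X) (set Rs)" and "distinct Rs" and xy: "x \<in> X" "y \<in> X"
  shows "(\<Sum>j<length Rs. of_bool ((x, y) \<in> Rs ! j)) = (1::real)"
proof -
  have "(x, y) \<in> \<Union> (set Rs)" using part xy by (simp add: partition_on_def)
  then obtain i where i: "i < length Rs" "(x, y) \<in> Rs ! i"
    by (auto simp: in_set_conv_nth)
  have "(x, y) \<in> Rs ! j \<longleftrightarrow> j = i" if j: "j < length Rs" for j
  proof
    assume "(x, y) \<in> Rs ! j"
    then have "Rs ! i \<inter> Rs ! j \<noteq> {}" using i(2) by blast
    then have "Rs ! i = Rs ! j"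
      using part i(1) j nth_mem[OF i(1)] nth_mem[OF j]
      unfolding partition_on_def disjoint_def by blast
    then show "j = i" using \<open>distinct Rs\<close> i(1) j by (simp add: nth_eq_iff_index_eq)
  qed (use i in simp)
  then have "(\<Sum>j<length Rs. of_bool ((x, y) \<in> Rs ! j)) = (\<Sum>j<length Rs. 1 * of_bool (j = i) :: real)"
    by (intro sum.cong) auto
  also have "\<dots> = 1" using i(1) by (intro sum_times_delta) auto
  finally show ?thesis .
qed

text \<open>
  This is where the eigenmatrix of a regular point is used: of the scheme only the three product
  formulas remain.
\<close>
lemma multiplication_table_of_eigenmatrix:
  fixes s t :: nat
  assumes "2 \<le> t" "t \<le> s" and card: "card X = s^2 * t"
    and len: "length Rs = (if s = t then 4 else 5)" and dist: "distinct Rs"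
    and Id: "Rs ! 0 = Id_on X"
    and scheme: "symmetric_association_scheme X (set Rs)"
    and P: "first_eigenmatrix X Rs (regP s t)"
  shows "regular_multiplication_table X s t (Rs ! 1) (Rs ! 2) (Rs ! 3) (if s = t then {} else Rs ! 4)"
    (is "regular_multiplication_table X s t ?B1 ?B2 ?B3 ?B4")
proof
  have part: "partition_on (X \<times> X) (set Rs)" and symm: "\<And>R. R \<in> set Rs \<Longrightarrow> sym R"
    and fin: "finite X"
    using scheme by (auto simp: symmetric_association_scheme_def association_scheme_def)
  then show "finite X" by blast
  have idx: "0 < length Rs" "1 < length Rs" "2 < length Rs" "3 < length Rs" "s \<noteq> t \<Longrightarrow> 4 < length Rs"
    by (simp_all add: len)
  have sub: "R \<subseteq> X \<times> X" if "R \<in> set Rs" for R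
    using part that by (auto simp: partition_on_def)
  show "?B1 \<subseteq> X \<times> X" "?B2 \<subseteq> X \<times> X" "?B3 \<subseteq> X \<times> X"
    using sub idx by simp_all
  show "?B4 \<subseteq> X \<times> X" using sub[of "Rs ! 4"] idx(5) by (cases "s = t") simp_all
  show "sym ?B1" "sym ?B2" "sym ?B3" using symm idx by simp_all
  show "sym ?B4" using symm[of "Rs ! 4"] idx(5) by (cases "s = t") (simp_all add: sym_def)
  fix x y assume xy: "x \<in> X" "y \<in> X"
  have Id_iff: "(x, y) \<in> Rs ! 0 \<longleftrightarrow> x = y" using xy by (simp add: Id Id_on_iff)
  show "of_bool (x = y) + of_bool ((x, y) \<in> ?B1) + of_bool ((x, y) \<in> ?B2)
      + of_bool ((x, y) \<in> ?B3) + of_bool ((x, y) \<in> ?B4) = (1::real)"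
  proof (cases "s = t")
    case True
    then have len4: "length Rs = 4" using len by simp
    show ?thesis
      using of_bool_sum_relations[OF part dist xy] True unfolding len4 sum_less_4 Id_iff by simp
  next
    case False
    then have len5: "length Rs = 5" using len by simp
    show ?thesis
      using of_bool_sum_relations[OF part dist xy] False unfolding len5 sum_less_5 Id_iff by simp
  qed
  note numbers = regP_intersection_numbers[OF P fin len _ _ xy, unfolded Id_iff]
  show "real (card {z \<in> X. (x, z) \<in> ?B1 \<and> (z, y) \<in> ?B1})
      = (real s - 1) * (real t + 1) * of_bool (x = y) + (real s - 2) * of_bool ((x, y) \<in> ?B1)
        + real t * of_bool ((x, y) \<in> ?B2) + (real t + 1) * of_bool ((x, y) \<in> ?B4)"
    using numbers[OF idx(2,2) regP_products_explicit(1)] by simp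
  show "real (card {z \<in> X. (x, z) \<in> ?B1 \<and> (z, y) \<in> ?B3}) = of_bool ((x, y) \<in> ?B2)"
    using numbers[OF idx(2,4) regP_products_explicit(2)] by simp
  show "real (card {z \<in> X. (x, z) \<in> ?B3 \<and> (z, y) \<in> ?B3})
      = (real t - 1) * of_bool (x = y) + (real t - 2) * of_bool ((x, y) \<in> ?B3)"
    using numbers[OF idx(4,4) regP_products_explicit(3)] by simp
qed (fact assms)+

section \<open>Graphs with the parameters of a generalised quadrangle\<close>

lemma sum_card_swap:
  assumes "finite A" "finite B"
  shows "(\<Sum>a\<in>A. card {b \<in> B. R a b}) = (\<Sum>b\<in>B. card {a \<in> A. R a b})"
  using assms by (intro sum_multicount_gen) auto

lemma two_elements:
  assumes "1 < card S"
  obtains p r where "p \<in> S" "r \<in> S" "p \<noteq> r"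
proof -
  have "finite S" using assms by (intro card_ge_0_finite) simp
  then show ?thesis using assms that card_le_Suc0_iff_eq[of S] by fastforce
qed

text \<open>
  A strongly regular graph with a base vertex, given by a vertex set and an adjacency predicate.
  The parameters are those of the collinearity graph of a generalised quadrangle of order \<open>(s, t)\<close>.
\<close>
locale gq_parameter_graph =
  fixes V :: "'a set" and adj :: "'a \<Rightarrow> 'a \<Rightarrow> bool" and s t :: nat and v :: 'a
  assumes finite_V: "finite V"
    and adj_V: "adj x y \<Longrightarrow> x \<in> V \<and> y \<in> V"
    and adj_sym: "adj x y \<Longrightarrow> adj y x"
    and adj_irrefl: "\<not> adj x x"
    and card_V: "card V = (s + 1) * (s * t + 1)"
    and degree: "x \<in> V \<Longrightarrow> card {z \<in> V. adj x z} = s * (t + 1)"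
    and adjacent: "adj x y \<Longrightarrow> card {z \<in> V. adj x z \<and> adj y z} = s - 1"
    and nonadjacent: "x \<in> V \<Longrightarrow> y \<in> V \<Longrightarrow> x \<noteq> y \<Longrightarrow> \<not> adj x y \<Longrightarrow>
      card {z \<in> V. adj x z \<and> adj y z} = t + 1"
    and t_ge_2: "2 \<le> t" and t_le_s: "t \<le> s" and v: "v \<in> V"
begin

definition N where "N = {p \<in> V. adj v p}"
definition H where "H = {x \<in> V. x \<noteq> v \<and> \<not> adj v x}"
text \<open>
  For \<open>x \<in> H\<close> this is \<open>{v, x}\<^sup>\<bottom>\<close>.
\<close>
definition M where "M x = {p \<in> N. adj x p}"
definition cls where "cls x = {y \<in> H. M y = M x}"

lemma s_ge_2: "2 \<le> s" using t_ge_2 t_le_s by simp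

lemma finite_N: "finite N" and finite_H: "finite H" and finite_M: "finite (M x)"
  and finite_cls: "finite (cls x)"
  using finite_V by (auto simp: N_def H_def M_def cls_def)

lemma N_not_H: "p \<in> N \<Longrightarrow> p \<notin> H" by (simp add: N_def H_def)

lemma v_notin: "v \<notin> N" "v \<notin> H" using adj_irrefl by (auto simp: N_def H_def)

lemma adj_comm: "adj x y \<longleftrightarrow> adj y x" using adj_sym by blast

lemma adj_v_N: "p \<in> N \<Longrightarrow> adj p v \<and> adj v p" using adj_sym by (auto simp: N_def)

lemma adj_v_H: "x \<in> H \<Longrightarrow> \<not> adj x v \<and> \<not> adj v x" using adj_sym by (auto simp: H_def)

lemma V_split: "V = insert v (N \<union> H)" using v by (auto simp: N_def H_def)

lemma card_split: "card {z \<in> V. Q z} = of_bool (Q v) + card {z \<in> N. Q z} + card {z \<in> H. Q z}"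
proof -
  have "{z \<in> V. Q z} = {z \<in> {v}. Q z} \<union> ({z \<in> N. Q z} \<union> {z \<in> H. Q z})"
    using V_split by auto
  moreover have "card ({z \<in> {v}. Q z} \<union> ({z \<in> N. Q z} \<union> {z \<in> H. Q z}))
      = card {z \<in> {v}. Q z} + card ({z \<in> N. Q z} \<union> {z \<in> H. Q z})"
    using finite_N finite_H v_notin by (intro card_Un_disjoint) auto
  moreover have "card ({z \<in> N. Q z} \<union> {z \<in> H. Q z}) = card {z \<in> N. Q z} + card {z \<in> H. Q z}"
  proof (rule card_Un_disjoint)
    show "{z \<in> N. Q z} \<inter> {z \<in> H. Q z} = {}" using N_not_H by blast
  qed (use finite_N finite_H in auto)
  moreover have "card {z \<in> {v}. Q z} = of_bool (Q v)"
  proof -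
    have "{z \<in> {v}. Q z} = (if Q v then {v} else {})" by auto
    then show ?thesis by simp
  qed
  ultimately show ?thesis by (simp only: add.assoc)
qed

lemma card_N: "card N = s * (t + 1)"
  using degree[OF v] by (simp add: N_def)

lemma card_H: "card H = s^2 * t"
proof -
  have "card V = 1 + card N + card H"
    using card_split[of "\<lambda>_. True"] by simp
  then have "(s + 1) * (s * t + 1) = 1 + s * (t + 1) + card H"
    by (simp add: card_N card_V)
  then show ?thesis by (simp add: algebra_simps power2_eq_square)
qed

lemma card_M:
  assumes "x \<in> H"
  shows "card (M x) = t + 1"
proof -
  have "M x = {z \<in> V. adj v z \<and> adj x z}" by (auto simp: M_def N_def)
  then show ?thesis using nonadjacent[of v x] v assms by (auto simp: H_def)
qed

lemma card_nbrs_in_H: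
  assumes "x \<in> H"
  shows "card {y \<in> H. adj x y} = (t + 1) * (s - 1)"
proof -
  have "x \<in> V" using assms by (simp add: H_def)
  then have "s * (t + 1) = card (M x) + card {y \<in> H. adj x y}"
    using card_split[of "adj x"] degree[of x] adj_v_H[OF assms] by (simp add: M_def)
  then have "s * (t + 1) = (t + 1) + card {y \<in> H. adj x y}"
    by (simp add: card_M[OF assms])
  then show ?thesis by (simp add: algebra_simps diff_mult_distrib2)
qed

lemma card_common_H_H:
  assumes "x \<in> H" "y \<in> H"
  shows "card {z \<in> V. adj x z \<and> adj y z} = card (M x \<inter> M y) + card {z \<in> H. adj x z \<and> adj y z}"
proof -
  have "M x \<inter> M y = {z \<in> N. adj x z \<and> adj y z}" by (auto simp: M_def)
  then show ?thesis
    using card_split[of "\<lambda>z. adj x z \<and> adj y z"] adj_v_H[OF assms(1)] by simp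
qed

lemma card_common_N_N:
  assumes "p \<in> N" "q \<in> N"
  shows "card {z \<in> V. adj p z \<and> adj q z}
    = 1 + card {r \<in> N. adj p r \<and> adj q r} + card {x \<in> H. adj p x \<and> adj q x}"
  using card_split[of "\<lambda>z. adj p z \<and> adj q z"] adj_v_N assms by simp

lemma card_common_H_N:
  assumes "x \<in> H"
  shows "card {z \<in> V. adj x z \<and> adj p z} = card {q \<in> M x. adj p q} + card {y \<in> H. adj x y \<and> adj p y}"
proof -
  have "{q \<in> M x. adj p q} = {z \<in> N. adj x z \<and> adj p z}" by (auto simp: M_def)
  then show ?thesis
    using card_split[of "\<lambda>z. adj x z \<and> adj p z"] adj_v_H[OF assms] by simp
qed

lemma card_nbrs_in_N:
  assumes "p \<in> N"
  shows "card {q \<in> N. adj p q} = s - 1"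
proof -
  have "{q \<in> N. adj p q} = {z \<in> V. adj v z \<and> adj p z}" by (auto simp: N_def)
  then show ?thesis using adjacent[of v p] assms by (simp add: N_def)
qed

lemma card_H_nbrs_of_N:
  assumes "p \<in> N"
  shows "card {x \<in> H. adj p x} = s * t"
proof -
  have "p \<in> V" using assms by (simp add: N_def)
  then have "s * (t + 1) = 1 + (s - 1) + card {x \<in> H. adj p x}"
    using card_split[of "adj p"] degree[of p] adj_v_N[OF assms] card_nbrs_in_N[OF assms] by simp
  then show ?thesis using s_ge_2 by simp
qed

lemma cls_M: "y \<in> cls x \<Longrightarrow> M y = M x" by (simp add: cls_def)

lemma H_with_p: "p \<in> N \<Longrightarrow> x \<in> H \<Longrightarrow> adj p x \<longleftrightarrow> p \<in> M x"
  by (simp add: M_def adj_comm[of p])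

text \<open>
  The condition that mediates between the local conditions and the scheme. The fibres of \<open>M\<close> are the
  points of a net whose lines are the vertices in \<open>N\<close>; the last two conjuncts say how the graph on
  \<open>H\<close> covers the collinearity graph of this net.
\<close>
definition net_at_v where
  "net_at_v \<longleftrightarrow>
    (\<forall>x\<in>H. card (cls x) = t) \<and>
    (\<forall>x\<in>H. \<forall>y\<in>H. M x \<noteq> M y \<longrightarrow> card (M x \<inter> M y) \<le> 1) \<and>
    (\<forall>x\<in>H. \<forall>y\<in>H. M x \<noteq> M y \<and> M x \<inter> M y \<noteq> {} \<longrightarrow> card {z \<in> cls y. adj x z} = 1) \<and>
    (\<forall>x\<in>H. \<forall>y\<in>H. adj x y \<longrightarrow> M x \<noteq> M y \<and> M x \<inter> M y \<noteq> {})"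

definition locally_cliques where
  "locally_cliques \<longleftrightarrow> (\<forall>p\<in>N. \<forall>q\<in>N. \<forall>r\<in>N. adj p q \<and> adj q r \<and> p \<noteq> r \<longrightarrow> adj p r)"

definition orth where "orth Y = {y \<in> V. \<forall>x\<in>Y. y = x \<or> adj y x}"

definition long_hyperbolic_lines where
  "long_hyperbolic_lines \<longleftrightarrow> (\<forall>x\<in>H.
     (\<forall>y\<in>orth (orth {v, x}). \<forall>z\<in>orth (orth {v, x}). \<not> adj y z) \<and>
     card (orth (orth {v, x})) = t + 1)"

lemma orth_pair: "x \<in> H \<Longrightarrow> orth {v, x} = M x"
  using adj_sym adj_irrefl by (auto simp: orth_def M_def N_def H_def)

text \<open>
  A vertex of \<open>H\<close> that is adjacent to all of \<open>M x\<close> has the same \<open>t + 1\<close> common neighbours with \<open>v\<close> as \<open>x\<close>.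
\<close>
lemma orth_M:
  assumes x: "x \<in> H" and no_N: "\<And>y. y \<in> orth (M x) \<Longrightarrow> y \<notin> N"
  shows "orth (M x) = insert v (cls x)"
proof
  show "insert v (cls x) \<subseteq> orth (M x)"
    using v by (auto simp: orth_def cls_def H_def M_def N_def)
  show "orth (M x) \<subseteq> insert v (cls x)"
  proof
    fix y assume y: "y \<in> orth (M x)"
    then consider "y = v" | "y \<in> H" using no_N V_split by (auto simp: orth_def)
    then show "y \<in> insert v (cls x)"
    proof cases
      case 2
      then have "M x \<subseteq> M y" using y N_not_H by (auto simp: orth_def M_def)
      then have "M x = M y"
        using card_M x 2 finite_M by (intro card_subset_eq) auto
      then show ?thesis using 2 by (simp add: cls_def)
    qed simp
  qed
qed

context
  assumes cliques: locally_cliques and hyp: long_hyperbolic_lines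
begin

text \<open>
  If \<open>p\<close> and \<open>r\<close> are adjacent, then \<open>v\<close> and the remaining \<open>s - 2\<close> vertices of their clique in \<open>N\<close> are
  all of their \<open>s - 1\<close> common neighbours, which leaves no room for \<open>x\<close>.
\<close>
lemma M_coclique:
  assumes x: "x \<in> H" and pr: "p \<in> M x" "r \<in> M x"
  shows "\<not> adj p r"
proof
  assume adj: "adj p r"
  have N: "p \<in> N" "r \<in> N" using pr by (auto simp: M_def)
  have "{q \<in> N. adj p q \<and> adj r q} = {q \<in> N. adj p q} - {r}"
    using cliques N adj adj_sym adj_irrefl unfolding locally_cliques_def by blast
  then have "card {q \<in> N. adj p q \<and> adj r q} = s - 2"
    using card_nbrs_in_N[OF N(1)] N adj finite_N by simp
  then have "card {x \<in> H. adj p x \<and> adj r x} = 0"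
    using card_common_N_N[OF N] adjacent[OF adj] s_ge_2 by linarith
  moreover have "x \<in> {x \<in> H. adj p x \<and> adj r x}"
    using x pr N H_with_p by blast
  ultimately show False using finite_H by auto
qed

lemma orth_M_eq:
  assumes "x \<in> H"
  shows "orth (M x) = insert v (cls x)"
proof (rule orth_M[OF assms])
  have "v \<in> orth (M x)" using v by (auto simp: orth_def M_def N_def)
  then show "y \<notin> N" if "y \<in> orth (M x)" for y
    using hyp assms that adj_v_N unfolding long_hyperbolic_lines_def orth_pair[OF assms] 
    using orth_pair[OF assms] by metis
qed

lemma card_cls: "x \<in> H \<Longrightarrow> card (cls x) = t"
  using hyp orth_pair orth_M_eq finite_cls v_notin
  by (auto simp: long_hyperbolic_lines_def cls_def)

lemma cls_coclique: "x \<in> H \<Longrightarrow> y \<in> cls x \<Longrightarrow> z \<in> cls x \<Longrightarrow> \<not> adj y z"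
  using hyp orth_pair orth_M_eq by (auto simp: long_hyperbolic_lines_def)

text \<open>
  The common neighbours of the nonadjacent vertices \<open>p\<close> and \<open>r\<close> are \<open>v\<close> and the fibre of \<open>x\<close>, by their
  number \<open>t + 1\<close>.
\<close>
lemma two_common_points:
  assumes x: "x \<in> H" and y: "y \<in> H" and pr: "p \<in> M x \<inter> M y" "r \<in> M x \<inter> M y" "p \<noteq> r"
  shows "M x = M y"
proof -
  let ?C = "{z \<in> H. adj p z \<and> adj r z}"
  have N: "p \<in> N" "r \<in> N" using pr by (auto simp: M_def)
  have "\<not> adj p r" using M_coclique[OF x] pr by blast
  then have "card {z \<in> V. adj p z \<and> adj r z} = t + 1"
    using nonadjacent[of p r] N pr(3) by (auto simp: N_def)
  then have "card ?C \<le> t" using card_common_N_N[OF N] by simp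
  moreover have "cls x \<subseteq> ?C"
    using pr N H_with_p by (auto simp: cls_def)
  ultimately have "cls x = ?C"
    using card_cls[OF x] finite_H by (intro card_seteq) auto
  moreover have "y \<in> ?C" using y pr N H_with_p by blast
  ultimately show ?thesis using cls_M by blast
qed

lemma card_M_Int_le:
  assumes "x \<in> H" "y \<in> H" "M x \<noteq> M y"
  shows "card (M x \<inter> M y) \<le> 1"
proof (rule ccontr)
  assume "\<not> ?thesis"
  then have "1 < card (M x \<inter> M y)" by simp
  then obtain p r where "p \<in> M x \<inter> M y" "r \<in> M x \<inter> M y" "p \<noteq> r" by (rule two_elements)
  then show False using two_common_points assms by blast
qed

lemma adj_M_neq:
  assumes "x \<in> H" "y \<in> H" "adj x y"
  shows "M x \<noteq> M y"
  using cls_coclique[of x x y] assms by (auto simp: cls_def)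

text \<open>
  Each \<open>p \<in> M x\<close> has \<open>s - 1\<close> common neighbours with \<open>x\<close>, all of them in \<open>H\<close>. The sum of
  \<open>card (M x \<inter> M y)\<close> over the \<open>(t + 1)(s - 1)\<close> neighbours \<open>y\<close> of \<open>x\<close> in \<open>H\<close> thus equals the number of
  summands, and no summand exceeds 1.
\<close>
lemma card_M_Int_adj:
  assumes x: "x \<in> H" and y: "y \<in> H" "adj x y"
  shows "card (M x \<inter> M y) = 1"
proof -
  let ?D = "{y \<in> H. adj x y}"
  have fin: "finite ?D" using finite_H by simp
  have Int: "M x \<inter> M y = {p \<in> M x. adj y p}" if "y \<in> ?D" for y
    by (auto simp: M_def)
  have "card {y \<in> ?D. adj y p} = s - 1" if "p \<in> M x" for p
  proof -
    have "adj x p" using that by (simp add: M_def)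
    moreover have "{q \<in> M x. adj p q} = {}" using M_coclique[OF x that] by blast
    then have "card {q \<in> M x. adj p q} = 0" by (simp only: card.empty)
    ultimately have "card {y \<in> H. adj x y \<and> adj p y} = s - 1"
      using card_common_H_N[OF x, of p] adjacent[of x p] by linarith
    then show ?thesis by (simp add: adj_comm[of _ p] conj_assoc)
  qed
  then have "(\<Sum>y\<in>?D. card (M x \<inter> M y)) = card (M x) * (s - 1)"
    using sum_card_swap[OF fin finite_M, of x "\<lambda>y p. adj y p"] Int by simp
  also have "\<dots> = (\<Sum>y\<in>?D. 1)"
    using card_M[OF x] card_nbrs_in_H[OF x] by simp
  finally have eq: "(\<Sum>y\<in>?D. card (M x \<inter> M y)) = (\<Sum>y\<in>?D. 1)" .
  have le: "card (M x \<inter> M y) \<le> 1" if "y \<in> ?D" for y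
    using that card_M_Int_le[OF x, of y] adj_M_neq[OF x, of y] by simp
  show ?thesis using sum_mono_inv[OF eq le _ fin, of y] y by simp
qed

text \<open>
  Two vertices in the fibre of \<open>y\<close> have \<open>M y\<close> as the set of all their common neighbours.
\<close>
lemma card_adj_cls_le:
  assumes x: "x \<in> H" and y: "y \<in> H"
  shows "card {z \<in> cls y. adj x z} \<le> 1"
proof (rule ccontr)
  assume "\<not> ?thesis"
  then have "1 < card {z \<in> cls y. adj x z}" by simp
  then obtain z z' where z: "z \<in> {z \<in> cls y. adj x z}" "z' \<in> {z \<in> cls y. adj x z}" "z \<noteq> z'"
    by (rule two_elements)
  let ?C = "{p \<in> V. adj z p \<and> adj z' p}"
  have "\<not> adj z z'" using cls_coclique[OF y] z by blast
  then have "card ?C = t + 1"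
    using nonadjacent[of z z'] z by (simp add: cls_def H_def)
  moreover have "M y \<subseteq> ?C" using z by (auto simp: cls_def M_def N_def)
  ultimately have "M y = ?C"
    using finite_V card_M[OF y] by (intro card_subset_eq) auto
  moreover have "x \<in> ?C" using z adj_sym adj_V by blast
  ultimately show False using x N_not_H by (auto simp: M_def)
qed

text \<open>
  Let \<open>Y\<close> be the set of all \<open>y\<close> as in the assumptions. It has \<open>(t + 1)(s - 1)t\<close> elements, and every
  neighbour of \<open>x\<close> in \<open>H\<close> lies in the fibre of exactly \<open>t\<close> of them. So on average over \<open>Y\<close> there is
  one neighbour in the fibre, and there is never more than one.
\<close>
lemma card_adj_cls_eq:
  assumes x: "x \<in> H" and y: "y \<in> H" "M x \<noteq> M y" "M x \<inter> M y \<noteq> {}"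
  shows "card {z \<in> cls y. adj x z} = 1"
proof -
  let ?D = "{y \<in> H. adj x y}" and ?Y = "{y \<in> H. M x \<noteq> M y \<and> M x \<inter> M y \<noteq> {}}"
  have fin: "finite ?D" "finite ?Y" using finite_H by simp_all
  have D_Y: "?D \<subseteq> ?Y"
    using card_M_Int_adj[OF x] adj_M_neq[OF x] by fastforce
  have card_Y: "card ?Y = (t + 1) * (s * t - t)"
  proof -
    have one: "card (M x \<inter> M y) = 1" if "y \<in> ?Y" for y
    proof -
      have "card (M x \<inter> M y) \<noteq> 0" using that finite_M by simp
      moreover have "card (M x \<inter> M y) \<le> 1" using card_M_Int_le[OF x, of y] that by simp
      ultimately show ?thesis by linarith
    qed
    have "card {y \<in> ?Y. adj y p} = s * t - t" if "p \<in> M x" for p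
    proof -
      have p: "p \<in> N" using that by (simp add: M_def)
      have "{y \<in> ?Y. adj y p} = {y \<in> H. adj p y} - cls x"
        using that p H_with_p adj_comm by (auto simp: cls_def M_def)
      moreover have "cls x \<subseteq> {y \<in> H. adj p y}"
        using that p H_with_p by (auto simp: cls_def)
      ultimately show ?thesis
        using card_Diff_subset[OF finite_cls] card_H_nbrs_of_N[OF p] card_cls[OF x] by simp
    qed
    then have "(\<Sum>y\<in>?Y. card {p \<in> M x. adj y p}) = card (M x) * (s * t - t)"
      using sum_card_swap[OF fin(2) finite_M, of x "\<lambda>y p. adj y p"] by simp
    moreover have "M x \<inter> M y = {p \<in> M x. adj y p}" for y by (auto simp: M_def)
    ultimately show ?thesis using one card_M[OF x] by simp
  qed
  have "(\<Sum>y\<in>?Y. card {z \<in> ?D. M z = M y}) = (\<Sum>z\<in>?D. card {y \<in> ?Y. M z = M y})"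
    by (rule sum_card_swap[OF fin(2,1)])
  also have "\<dots> = (\<Sum>z\<in>?D. t)"
  proof (intro sum.cong refl)
    fix z assume z: "z \<in> ?D"
    then have "{y \<in> ?Y. M z = M y} = cls z" using D_Y by (auto simp: cls_def)
    then show "card {y \<in> ?Y. M z = M y} = t" using card_cls z by simp
  qed
  also have "\<dots> = (\<Sum>y\<in>?Y. 1)"
    using card_nbrs_in_H[OF x] card_Y by (simp add: algebra_simps diff_mult_distrib2)
  finally have sum: "(\<Sum>y\<in>?Y. card {z \<in> ?D. M z = M y}) = (\<Sum>y\<in>?Y. 1)" .
  have eq: "{z \<in> ?D. M z = M y} = {z \<in> cls y. adj x z}" for y
    by (auto simp: cls_def)
  have "card {z \<in> ?D. M z = M y} = 1"
    using sum_mono_inv[OF sum _ _ fin(2), of y] card_adj_cls_le[OF x] y unfolding eq by simp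
  then show ?thesis unfolding eq .
qed

lemma net_at_v_from_local_conditions: net_at_v
  unfolding net_at_v_def
proof (intro conjI ballI impI)
  fix x y assume xy: "x \<in> H" "y \<in> H"
  show "card (cls x) = t" using card_cls xy by simp
  show "card (M x \<inter> M y) \<le> 1" if "M x \<noteq> M y" using card_M_Int_le xy that by blast
  show "card {z \<in> cls y. adj x z} = 1" if "M x \<noteq> M y \<and> M x \<inter> M y \<noteq> {}"
    using card_adj_cls_eq xy that by blast
  assume "adj x y"
  then show "M x \<noteq> M y" using adj_M_neq xy by blast
  show "M x \<inter> M y \<noteq> {}" using card_M_Int_adj[OF xy \<open>adj x y\<close>] by force
qed

end

context
  assumes net: net_at_v
begin

lemma net_card_cls: "x \<in> H \<Longrightarrow> card (cls x) = t"
  using net by (simp add: net_at_v_def)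

lemma net_adj: "x \<in> H \<Longrightarrow> y \<in> H \<Longrightarrow> adj x y \<Longrightarrow> M x \<noteq> M y"
  using net by (simp add: net_at_v_def)

lemma net_adj_cls:
  "x \<in> H \<Longrightarrow> y \<in> H \<Longrightarrow> M x \<noteq> M y \<Longrightarrow> p \<in> M x \<Longrightarrow> p \<in> M y \<Longrightarrow> card {z \<in> cls y. adj x z} = 1"
  using net unfolding net_at_v_def by blast

text \<open>
  The \<open>st\<close> neighbours of \<open>p\<close> in \<open>H\<close> form \<open>s\<close> fibres. The fibre of \<open>x\<close> contains no neighbour of \<open>x\<close>, each of
  the others exactly one. The proof counts pairs of a neighbour \<open>z\<close> and an element \<open>y\<close> of its fibre.
\<close>
lemma net_common_nbrs_H_N:
  assumes x: "x \<in> H" and p: "p \<in> M x"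
  shows "card {z \<in> H. adj x z \<and> adj p z} = s - 1"
proof -
  let ?D = "{z \<in> H. adj x z \<and> adj p z}" and ?P = "{y \<in> H. adj p y}"
  have fin: "finite ?D" "finite ?P" using finite_H by simp_all
  have N: "p \<in> N" using p by (simp add: M_def)
  have sub: "cls x \<subseteq> ?P" using p N H_with_p by (auto simp: cls_def)
  have "(\<Sum>z\<in>?D. card {y \<in> ?P. M z = M y}) = (\<Sum>z\<in>?D. t)"
  proof (intro sum.cong refl)
    fix z assume z: "z \<in> ?D"
    then have "{y \<in> ?P. M z = M y} = cls z"
      using N H_with_p by (auto simp: cls_def)
    then show "card {y \<in> ?P. M z = M y} = t" using z net_card_cls by simp
  qed
  moreover have "(\<Sum>y\<in>?P. card {z \<in> ?D. M z = M y}) = (\<Sum>y\<in>?P. of_bool (y \<notin> cls x))"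
  proof (intro sum.cong refl)
    fix y assume y: "y \<in> ?P"
    then have py: "p \<in> M y" using N H_with_p by blast
    show "card {z \<in> ?D. M z = M y} = of_bool (y \<notin> cls x)"
    proof (cases "y \<in> cls x")
      case True
      then have "{z \<in> ?D. M z = M y} = {}" using net_adj[OF x] cls_M by fastforce
      then show ?thesis using True by (simp only: card.empty) simp
    next
      case False
      then have "M x \<noteq> M y" using y by (auto simp: cls_def)
      moreover have "{z \<in> ?D. M z = M y} = {z \<in> cls y. adj x z}"
        using py N H_with_p by (auto simp: cls_def)
      ultimately show ?thesis using net_adj_cls[OF x _ _ p py] y False by simp
    qed
  qed
  moreover have "(\<Sum>y\<in>?P. of_bool (y \<notin> cls x)) = card (?P - cls x)"
    using fin by (simp add: Diff_eq Compl_eq)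
  ultimately have "card ?D * t = card (?P - cls x)"
    using sum_card_swap[OF fin, of "\<lambda>z y. M z = M y"] by simp
  also have "\<dots> = s * t - t"
    using card_Diff_subset[OF finite_cls sub] card_H_nbrs_of_N[OF N] net_card_cls[OF x] by simp
  also have "\<dots> = (s - 1) * t" by (simp add: diff_mult_distrib)
  finally show ?thesis using t_ge_2 by simp
qed

text \<open>
  For \<open>p \<in> M x\<close> all \<open>s - 1\<close> common neighbours with \<open>x\<close> have just been found in \<open>H\<close>.
\<close>
lemma net_M_coclique:
  assumes x: "x \<in> H" and pr: "p \<in> M x" "r \<in> M x"
  shows "\<not> adj p r"
proof
  assume "adj p r"
  have "adj x p" using pr by (simp add: M_def)
  then have "card {q \<in> M x. adj p q} = 0"
    using card_common_H_N[OF x, of p] adjacent[of x p] net_common_nbrs_H_N[OF x pr(1)] by simp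
  then show False using pr \<open>adj p r\<close> finite_M by auto
qed

text \<open>
  The \<open>t + 1\<close> common neighbours of \<open>p\<close> and \<open>r\<close> are \<open>v\<close> and the fibre of \<open>x\<close>.
\<close>
lemma net_no_common_nbr_in_N:
  assumes x: "x \<in> H" and pr: "p \<in> M x" "r \<in> M x" "p \<noteq> r" and q: "q \<in> N" "adj p q" "adj r q"
  shows False
proof -
  have N: "p \<in> N" "r \<in> N" using pr by (auto simp: M_def)
  have "card {z \<in> V. adj p z \<and> adj r z} = t + 1"
    using nonadjacent[of p r] N pr(3) net_M_coclique[OF x pr(1,2)] by (auto simp: N_def)
  moreover have "cls x \<subseteq> {y \<in> H. adj p y \<and> adj r y}"
    using pr N H_with_p by (auto simp: cls_def)
  then have "t \<le> card {y \<in> H. adj p y \<and> adj r y}"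
    using card_mono[of "{y \<in> H. adj p y \<and> adj r y}" "cls x"] finite_H net_card_cls[OF x] by simp
  ultimately have "card {q \<in> N. adj p q \<and> adj r q} = 0"
    using card_common_N_N[OF N] by simp
  then show False using q finite_N by auto
qed

text \<open>
  There are \<open>st\<close> vertices \<open>r\<close> in \<open>N\<close> not adjacent to \<open>p\<close>, and \<open>st\<close> neighbours \<open>x\<close> of \<open>p\<close> in \<open>H\<close>, each of them
  adjacent to \<open>t\<close> such \<open>r\<close>. So on average an \<open>r\<close> has \<open>t\<close> common neighbours with \<open>p\<close> in \<open>H\<close>, and it cannot
  have more, as \<open>v\<close> is another one.
\<close>
lemma net_nonadjacent_common_nbr:
  assumes p: "p \<in> N" and r: "r \<in> N" "r \<noteq> p" "\<not> adj p r"
  shows "\<exists>x\<in>H. p \<in> M x \<and> r \<in> M x"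
proof -
  let ?R = "{r \<in> N. r \<noteq> p \<and> \<not> adj p r}" and ?P = "{x \<in> H. adj p x}"
  have fin: "finite ?R" "finite ?P" using finite_N finite_H by simp_all
  have card_R: "card ?R = s * t"
  proof -
    have "?R = N - insert p {q \<in> N. adj p q}" using adj_irrefl by auto
    moreover have "card (insert p {q \<in> N. adj p q}) = s"
      using card_nbrs_in_N[OF p] finite_N adj_irrefl s_ge_2 by simp
    ultimately have "card ?R = s * (t + 1) - s"
      using card_Diff_subset[of "insert p {q \<in> N. adj p q}" N] p finite_N card_N by auto
    then show ?thesis by simp
  qed
  have "card {r \<in> ?R. adj r x} = t" if x: "x \<in> ?P" for x
  proof -
    have px: "p \<in> M x" and xH: "x \<in> H" using x p H_with_p by auto
    have "{r \<in> ?R. adj r x} = M x - {p}"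
      using net_M_coclique[OF xH px] H_with_p xH by (auto simp: M_def adj_comm[of _ x])
    then show ?thesis using card_M[OF xH] px finite_M by simp
  qed
  then have "(\<Sum>r\<in>?R. card {x \<in> ?P. adj r x}) = (\<Sum>r\<in>?R. t)"
    using sum_card_swap[OF fin, of adj] card_R card_H_nbrs_of_N[OF p] by simp
  moreover have "card {x \<in> ?P. adj r x} \<le> t" if "r \<in> ?R" for r
  proof -
    have "card {z \<in> V. adj p z \<and> adj r z} = t + 1"
      using nonadjacent[of p r] p that by (auto simp: N_def)
    then show ?thesis using card_common_N_N[OF p, of r] that by (simp add: conj_assoc)
  qed
  ultimately have "card {x \<in> ?P. adj r x} = t"
    using fin r by (intro sum_mono_inv[of "\<lambda>r. card {x \<in> ?P. adj r x}" ?R "\<lambda>_. t" r]) auto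
  then have "{x \<in> ?P. adj r x} \<noteq> {}" using t_ge_2 by (metis card.empty not_numeral_le_zero)
  then obtain x where "x \<in> H" "adj p x" "adj r x" by blast
  then show ?thesis using p r H_with_p by blast
qed

lemma net_locally_cliques: locally_cliques
  unfolding locally_cliques_def
proof (intro ballI impI)
  fix p q r assume pqr: "p \<in> N" "q \<in> N" "r \<in> N" "adj p q \<and> adj q r \<and> p \<noteq> r"
  show "adj p r"
  proof (rule ccontr)
    assume "\<not> adj p r"
    then obtain x where "x \<in> H" "p \<in> M x" "r \<in> M x"
      using net_nonadjacent_common_nbr[of p r] pqr by blast
    then show False using net_no_common_nbr_in_N[of x p r q] pqr adj_sym by blast
  qed
qed

text \<open>
  As \<open>t + 1 \<ge> 3\<close>, a vertex of \<open>N\<close> in \<open>orth (M x)\<close> would be a common neighbour of two elements of \<open>M x\<close>.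
\<close>
lemma net_orth_M:
  assumes x: "x \<in> H"
  shows "orth (M x) = insert v (cls x)"
proof (rule orth_M[OF x], rule notI)
  fix y assume y: "y \<in> orth (M x)" "y \<in> N"
  have "1 < card (M x - {y})"
    using card_M[OF x] t_ge_2 finite_M[of x] by (simp add: card_Diff_singleton_if)
  then obtain p r where pr: "p \<in> M x - {y}" "r \<in> M x - {y}" "p \<noteq> r" by (rule two_elements)
  then have "adj y p" "adj y r" using y(1) by (auto simp: orth_def)
  then show False
    using net_no_common_nbr_in_N[OF x, of p r y] pr y(2) adj_sym by blast
qed

lemma net_long_hyperbolic_lines: long_hyperbolic_lines
  unfolding long_hyperbolic_lines_def
proof (intro ballI conjI)
  fix x assume x: "x \<in> H"
  have eq: "orth (orth {v, x}) = insert v (cls x)"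
    using orth_pair[OF x] net_orth_M[OF x] by simp
  show "card (orth (orth {v, x})) = t + 1"
    unfolding eq using net_card_cls[OF x] finite_cls v_notin by (simp add: cls_def)
  show "\<not> adj y z" if "y \<in> orth (orth {v, x})" "z \<in> orth (orth {v, x})" for y z
    using that net_adj[of y z] adj_v_H adj_irrefl unfolding eq by (auto simp: cls_def)
qed

end

theorem local_conditions_iff_net: "locally_cliques \<and> long_hyperbolic_lines \<longleftrightarrow> net_at_v"
  using net_at_v_from_local_conditions net_locally_cliques net_long_hyperbolic_lines by blast

end

section \<open>The net and the multiplication table\<close>

context gq_parameter_graph
begin

definition adj_H where "adj_H = {(x, y) \<in> H \<times> H. adj x y}"

lemma adj_H_iff: "(x, y) \<in> adj_H \<longleftrightarrow> x \<in> H \<and> y \<in> H \<and> adj x y"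
  by (simp add: adj_H_def)

lemma H_V: "x \<in> H \<Longrightarrow> x \<in> V" by (simp add: H_def)

lemma common_nbrs_in_H_eq:
  assumes "x \<in> H" "y \<in> H"
  shows "{z \<in> H. (x, z) \<in> adj_H \<and> (z, y) \<in> adj_H} = {z \<in> H. adj x z \<and> adj y z}"
  using assms by (auto simp: adj_H_iff adj_comm[of _ y])

text \<open>
  This and the next lemma express the path counts in \<open>H\<close> by the sizes of the sets \<open>M x \<inter> M y\<close>.
\<close>
lemma card_Int_M_plus_adj:
  assumes "x \<in> H" "y \<in> H" "adj x y"
  shows "card (M x \<inter> M y) + card {z \<in> H. (x, z) \<in> adj_H \<and> (z, y) \<in> adj_H} = s - 1"
  unfolding common_nbrs_in_H_eq[OF assms(1,2)]
  using card_common_H_H[OF assms(1,2)] adjacent[OF assms(3)] by simp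

lemma card_Int_M_plus_nonadj:
  assumes "x \<in> H" "y \<in> H" "x \<noteq> y" "\<not> adj x y"
  shows "card (M x \<inter> M y) + card {z \<in> H. (x, z) \<in> adj_H \<and> (z, y) \<in> adj_H} = t + 1"
  unfolding common_nbrs_in_H_eq[OF assms(1,2)]
  using card_common_H_H[OF assms(1,2)] nonadjacent[OF H_V H_V assms(3,4)] assms(1,2) by simp

lemma M_eq_iff_card:
  assumes "x \<in> H" "y \<in> H"
  shows "M x = M y \<longleftrightarrow> card (M x \<inter> M y) = t + 1"
proof
  assume "card (M x \<inter> M y) = t + 1"
  then have "card (M x \<inter> M y) = card (M x)" "card (M x \<inter> M y) = card (M y)"
    using card_M assms by simp_all
  then have "M x \<inter> M y = M x" "M x \<inter> M y = M y"
    using finite_M by (meson card_subset_eq Int_lower1 Int_lower2)+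
  then show "M x = M y" by simp
qed (use card_M assms in simp)

definition meet_H where
  "meet_H = {(x, y) \<in> H \<times> H. M x \<noteq> M y \<and> M x \<inter> M y \<noteq> {} \<and> \<not> adj x y}"
definition same_H where
  "same_H = {(x, y) \<in> H \<times> H. x \<noteq> y \<and> M x = M y}"
definition skew_H where
  "skew_H = {(x, y) \<in> H \<times> H. M x \<inter> M y = {}}"

lemma net_imp_table:
  assumes net: net_at_v
  shows "regular_multiplication_table H s t adj_H meet_H same_H skew_H"
proof
  show "2 \<le> t" "t \<le> s" "finite H" "card H = s^2 * t"
    by (fact t_ge_2 t_le_s finite_H card_H)+
  show "adj_H \<subseteq> H \<times> H" "meet_H \<subseteq> H \<times> H" "same_H \<subseteq> H \<times> H" "skew_H \<subseteq> H \<times> H"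
    by (auto simp: adj_H_def meet_H_def same_H_def skew_H_def)
  show "sym adj_H" "sym meet_H" "sym same_H" "sym skew_H"
    using adj_sym by (auto simp: adj_H_def meet_H_def same_H_def skew_H_def intro!: symI)
  fix x y assume xy: "x \<in> H" "y \<in> H"
  have M_ne: "M z \<noteq> {}" if "z \<in> H" for z using card_M[OF that] by force
  have adj_meet: "M x \<noteq> M y \<and> M x \<inter> M y \<noteq> {}" if "adj x y"
    using net xy that by (simp add: net_at_v_def)
  have meet_one: "card (M x \<inter> M y) = 1" if "M x \<noteq> M y" "M x \<inter> M y \<noteq> {}"
  proof -
    have "card (M x \<inter> M y) \<le> 1" using net xy that by (simp add: net_at_v_def)
    moreover have "card (M x \<inter> M y) \<noteq> 0" using that(2) finite_M by simp
    ultimately show ?thesis by linarith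
  qed
  have s: "real (s - 1) = real s - 1" using s_ge_2 by simp
  consider (Id) "x = y" | (adj) "x \<noteq> y" "adj x y"
    | (meet) "x \<noteq> y" "\<not> adj x y" "M x \<noteq> M y" "M x \<inter> M y \<noteq> {}"
    | (same) "x \<noteq> y" "\<not> adj x y" "M x = M y" | (skew) "x \<noteq> y" "\<not> adj x y" "M x \<inter> M y = {}"
    by blast
  note case_split = this
  have in_rel: "((x, y) \<in> adj_H \<longleftrightarrow> adj x y)"
    "((x, y) \<in> meet_H \<longleftrightarrow> M x \<noteq> M y \<and> M x \<inter> M y \<noteq> {} \<and> \<not> adj x y)"
    "((x, y) \<in> same_H \<longleftrightarrow> x \<noteq> y \<and> M x = M y)" "((x, y) \<in> skew_H \<longleftrightarrow> M x \<inter> M y = {})"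
    using xy by (auto simp: adj_H_def meet_H_def same_H_def skew_H_def)
  show "of_bool (x = y) + of_bool ((x, y) \<in> adj_H) + of_bool ((x, y) \<in> meet_H)
      + of_bool ((x, y) \<in> same_H) + of_bool ((x, y) \<in> skew_H) = (1::real)"
    unfolding in_rel
    by (rule case_split) (use adj_meet M_ne[OF xy(1)] M_ne[OF xy(2)] adj_irrefl in auto)
  show "real (card {z \<in> H. (x, z) \<in> adj_H \<and> (z, y) \<in> adj_H})
      = (real s - 1) * (real t + 1) * of_bool (x = y) + (real s - 2) * of_bool ((x, y) \<in> adj_H)
        + real t * of_bool ((x, y) \<in> meet_H) + (real t + 1) * of_bool ((x, y) \<in> skew_H)"
    (is "real ?n = ?rhs")
  proof (rule case_split)
    assume "x = y"
    then have "?n = (t + 1) * (s - 1)"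
      unfolding common_nbrs_in_H_eq[OF xy] using card_nbrs_in_H[OF xy(1)] by simp
    then have "real ?n = (real t + 1) * (real s - 1)"
      by (simp only: of_nat_mult of_nat_add of_nat_1 s)
    then show ?thesis
      unfolding in_rel using \<open>x = y\<close> M_ne[OF xy(1)] adj_irrefl by (simp add: mult.commute)
  next
    assume "x \<noteq> y" "adj x y"
    then have "1 + ?n = s - 1"
      using card_Int_M_plus_adj[OF xy] meet_one adj_meet by simp
    then have "real ?n = real s - 2" using s by linarith
    then show ?thesis unfolding in_rel using \<open>x \<noteq> y\<close> \<open>adj x y\<close> adj_meet by simp
  next
    assume *: "x \<noteq> y" "\<not> adj x y" "M x \<noteq> M y" "M x \<inter> M y \<noteq> {}"
    then have "1 + ?n = t + 1"
      using card_Int_M_plus_nonadj[OF xy] meet_one by simp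
    then show ?thesis unfolding in_rel using * by simp
  next
    assume *: "x \<noteq> y" "\<not> adj x y" "M x = M y"
    then have "(t + 1) + ?n = t + 1"
      using card_Int_M_plus_nonadj[OF xy] M_eq_iff_card[OF xy] by simp
    then show ?thesis unfolding in_rel using * M_ne[OF xy(2)] by simp
  next
    assume *: "x \<noteq> y" "\<not> adj x y" "M x \<inter> M y = {}"
    then have "0 + ?n = t + 1"
      using card_Int_M_plus_nonadj[OF xy] by simp
    moreover have "M x \<noteq> M y" using * M_ne[OF xy(2)] by auto
    ultimately show ?thesis unfolding in_rel using * by simp
  qed
  show "real (card {z \<in> H. (x, z) \<in> adj_H \<and> (z, y) \<in> same_H}) = of_bool ((x, y) \<in> meet_H)"
  proof -
    have eq: "{z \<in> H. (x, z) \<in> adj_H \<and> (z, y) \<in> same_H} = {z \<in> cls y. adj x z} - {y}"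
      using xy by (auto simp: adj_H_def same_H_def cls_def)
    show ?thesis
    proof (cases "M x \<noteq> M y \<and> M x \<inter> M y \<noteq> {}")
      case True
      then have one: "card {z \<in> cls y. adj x z} = 1" using net xy by (simp add: net_at_v_def)
      show ?thesis
      proof (cases "adj x y")
        case adj: True
        then have "y \<in> {z \<in> cls y. adj x z}" using xy by (simp add: cls_def)
        then have "card ({z \<in> cls y. adj x z} - {y}) = 0"
          using one by (simp add: card_Diff_singleton)
        then show ?thesis unfolding eq in_rel using adj by simp
      next
        case False
        then have "{z \<in> cls y. adj x z} - {y} = {z \<in> cls y. adj x z}" by auto
        then show ?thesis unfolding eq in_rel using one True False by simp
      qed
    next
      case False
      have "\<not> adj x z" if "z \<in> cls y" for z
      proof
        assume "adj x z"
        moreover have "z \<in> H" "M z = M y" using that by (auto simp: cls_def)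
        ultimately have "M x \<noteq> M z \<and> M x \<inter> M z \<noteq> {}"
          using net xy(1) unfolding net_at_v_def by blast
        with \<open>M z = M y\<close> False show False by simp
      qed
      then have "{z \<in> cls y. adj x z} - {y} = {}" by blast
      then have "card ({z \<in> cls y. adj x z} - {y}) = 0" by (simp only: card.empty)
      then show ?thesis unfolding eq in_rel using False by auto
    qed
  qed
  show "real (card {z \<in> H. (x, z) \<in> same_H \<and> (z, y) \<in> same_H})
      = (real t - 1) * of_bool (x = y) + (real t - 2) * of_bool ((x, y) \<in> same_H)"
  proof (cases "M x = M y")
    case True
    have "{z \<in> H. (x, z) \<in> same_H \<and> (z, y) \<in> same_H} = cls x - {x, y}"
      using xy True by (auto simp: same_H_def cls_def)
    moreover have "{x, y} \<subseteq> cls x" using xy True by (simp add: cls_def)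
    moreover have "card (cls x) = t" using net xy by (simp add: net_at_v_def)
    ultimately have "card {z \<in> H. (x, z) \<in> same_H \<and> (z, y) \<in> same_H} = t - card {x, y}"
      using card_Diff_subset[of "{x, y}" "cls x"] by simp
    then show ?thesis unfolding in_rel using True t_ge_2 by (cases "x = y") (simp_all add: of_nat_diff)
  next
    case False
    then have "{z \<in> H. (x, z) \<in> same_H \<and> (z, y) \<in> same_H} = {}"
      by (auto simp: same_H_def)
    then have "card {z \<in> H. (x, z) \<in> same_H \<and> (z, y) \<in> same_H} = 0"
      by (simp only: card.empty)
    then show ?thesis unfolding in_rel using False by auto
  qed
qed

text \<open>
  The formula for \<open>B\<^sub>1B\<^sub>1\<close> gives \<open>card (M x \<inter> M y)\<close>, which is 1 on \<open>B\<^sub>1\<close> and \<open>B\<^sub>2\<close>, \<open>t + 1\<close> on \<open>B\<^sub>3\<close> and 0 on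
  \<open>B\<^sub>4\<close>. Hence the relations \<open>B2\<close>, \<open>B3\<close>, \<open>B4\<close> are the intended ones, and the other two formulas count the
  elements of a fibre and the neighbours in a fibre.
\<close>
lemma table_imp_net:
  assumes "regular_multiplication_table H s t adj_H B2 B3 B4"
  shows net_at_v
proof -
  interpret T: regular_multiplication_table H s t adj_H B2 B3 B4 by (fact assms)
  have s: "real (s - 1) = real s - 1" using s_ge_2 by simp
  have Int: "real (card (M x \<inter> M y)) = of_bool ((x, y) \<in> adj_H) + of_bool ((x, y) \<in> B2)
      + (real t + 1) * of_bool ((x, y) \<in> B3)"
    if xy: "x \<in> H" "y \<in> H" "x \<noteq> y" for x y
  proof -
    have one: "of_bool ((x, y) \<in> adj_H) + of_bool ((x, y) \<in> B2)
      + of_bool ((x, y) \<in> B3) + of_bool ((x, y) \<in> B4) = (1::real)"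
      using T.exactly_one[OF xy(1,2)] xy(3) by simp
    let ?n = "card {z \<in> H. (x, z) \<in> adj_H \<and> (z, y) \<in> adj_H}"
    have n: "real ?n = (real s - 2) * of_bool ((x, y) \<in> adj_H)
        + real t * of_bool ((x, y) \<in> B2) + (real t + 1) * of_bool ((x, y) \<in> B4)"
      using T.B1_B1[OF xy(1,2)] xy(3) by simp
    show ?thesis
    proof (cases "adj x y")
      case True
      then have a: "of_bool ((x, y) \<in> adj_H) = (1::real)" using xy by (simp add: adj_H_iff)
      have "of_bool ((x, y) \<in> B2) = (0::real) \<and> of_bool ((x, y) \<in> B3) = (0::real)
          \<and> of_bool ((x, y) \<in> B4) = (0::real)"
        using one unfolding a by (auto simp: of_bool_def split: if_splits)
      moreover have "real (card (M x \<inter> M y)) + real ?n = real s - 1"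
        using card_Int_M_plus_adj[OF xy(1,2) True] s by linarith
      ultimately show ?thesis using n unfolding a by simp
    next
      case False
      then have a: "of_bool ((x, y) \<in> adj_H) = (0::real)" by (simp add: adj_H_iff)
      have "real (card (M x \<inter> M y)) + real ?n = real t + 1"
        using card_Int_M_plus_nonadj[OF xy False] by linarith
      moreover have "(real t + 1) * of_bool ((x, y) \<in> B2) + (real t + 1) * of_bool ((x, y) \<in> B3)
          + (real t + 1) * of_bool ((x, y) \<in> B4) = real t + 1"
        using one unfolding a by (simp flip: distrib_left)
      ultimately show ?thesis using n unfolding a by (simp add: algebra_simps)
    qed
  qed
  have cases: "(x, y) \<in> adj_H \<and> (x, y) \<notin> B2 \<and> (x, y) \<notin> B3 \<or> (x, y) \<notin> adj_H \<and> (x, y) \<in> B2 \<and> (x, y) \<notin> B3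
      \<or> (x, y) \<notin> adj_H \<and> (x, y) \<notin> B2 \<and> (x, y) \<in> B3 \<or> (x, y) \<notin> adj_H \<and> (x, y) \<notin> B2 \<and> (x, y) \<notin> B3"
    if "x \<in> H" "y \<in> H" "x \<noteq> y" for x y
    using T.exactly_one[OF that(1,2)] that(3) by (auto simp: of_bool_def split: if_splits)
  have same: "M x = M y \<longleftrightarrow> (x, y) \<in> B3" if xy: "x \<in> H" "y \<in> H" "x \<noteq> y" for x y
  proof -
    have "M x = M y \<longleftrightarrow> real (card (M x \<inter> M y)) = real t + 1"
      using M_eq_iff_card[OF xy(1,2)] by linarith
    then show ?thesis unfolding Int[OF xy] using cases[OF xy] t_ge_2 by auto
  qed
  have meet: "M x \<inter> M y \<noteq> {} \<longleftrightarrow> (x, y) \<in> adj_H \<or> (x, y) \<in> B2"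
    if xy: "x \<in> H" "y \<in> H" "M x \<noteq> M y" for x y
  proof -
    have "x \<noteq> y" using xy by blast
    have "M x \<inter> M y \<noteq> {} \<longleftrightarrow> real (card (M x \<inter> M y)) \<noteq> 0" using finite_M by simp
    then show ?thesis
      unfolding Int[OF xy(1,2) \<open>x \<noteq> y\<close>] using same[OF xy(1,2) \<open>x \<noteq> y\<close>] xy(3) by auto
  qed
  have not_B3: "(x, x) \<notin> B3" if "x \<in> H" for x using T.diag[OF that] by blast
  have B3_H: "x \<in> H \<and> y \<in> H" if "(x, y) \<in> B3" for x y using T.sub that by blast
  show ?thesis
    unfolding net_at_v_def
  proof (intro conjI ballI impI)
    fix x assume x: "x \<in> H"
    have "{z \<in> H. (x, z) \<in> B3 \<and> (z, x) \<in> B3} = cls x - {x}"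
    proof (rule set_eqI)
      fix z
      have "(x, z) \<in> B3 \<longleftrightarrow> (z, x) \<in> B3" using T.sym(3) by (auto dest: symD)
      then show "z \<in> {z \<in> H. (x, z) \<in> B3 \<and> (z, x) \<in> B3} \<longleftrightarrow> z \<in> cls x - {x}"
        using same[of z x] x not_B3[OF x] by (cases "z = x") (auto simp: cls_def)
    qed
    then have "real (card (cls x - {x})) = real t - 1" using T.valency_B3[OF x] by simp
    moreover have "x \<in> cls x" using x by (simp add: cls_def)
    ultimately have "card (cls x) = t"
      using card_Suc_Diff1[OF finite_cls \<open>x \<in> cls x\<close>] by linarith
    then show "card (cls x) = t" .
    fix y assume y: "y \<in> H"
    show "card (M x \<inter> M y) \<le> 1" if ne: "M x \<noteq> M y"
    proof -
      have xy: "x \<noteq> y" using ne by blast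
      have "real (card (M x \<inter> M y)) \<le> 1"
        unfolding Int[OF x y xy] using same[OF x y xy] cases[OF x y xy] ne by auto
      then show ?thesis by simp
    qed
    show "card {z \<in> cls y. adj x z} = 1" if ne: "M x \<noteq> M y \<and> M x \<inter> M y \<noteq> {}"
    proof -
      have xy: "x \<noteq> y" using ne by blast
      have rel: "(x, y) \<in> adj_H \<or> (x, y) \<in> B2" using meet[OF x y] ne by blast
      have eq: "{z \<in> H. (x, z) \<in> adj_H \<and> (z, y) \<in> B3} = {z \<in> cls y. adj x z} - {y}"
      proof (rule set_eqI)
        fix z
        show "z \<in> {z \<in> H. (x, z) \<in> adj_H \<and> (z, y) \<in> B3} \<longleftrightarrow> z \<in> {z \<in> cls y. adj x z} - {y}"
          using same[of z y] x y not_B3[OF y] by (cases "z = y") (auto simp: cls_def adj_H_iff)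
      qed
      have n: "real (card ({z \<in> cls y. adj x z} - {y})) = of_bool ((x, y) \<in> B2)"
        using T.B1_B3[OF x y] unfolding eq .
      show ?thesis
      proof (cases "adj x y")
        case True
        then have "(x, y) \<notin> B2" using cases[OF x y xy] x y by (auto simp: adj_H_iff)
        then have "card ({z \<in> cls y. adj x z} - {y}) = 0" using n by simp
        moreover have "y \<in> {z \<in> cls y. adj x z}" using y True by (simp add: cls_def)
        moreover have "finite {z \<in> cls y. adj x z}" using finite_cls by simp
        ultimately show ?thesis
          using card_Suc_Diff1[of "{z \<in> cls y. adj x z}" y] by linarith
      next
        case False
        then have "{z \<in> cls y. adj x z} - {y} = {z \<in> cls y. adj x z}" by auto
        moreover have "(x, y) \<in> B2" using rel False by (simp add: adj_H_iff)
        ultimately show ?thesis using n by simp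
      qed
    qed
    assume adj: "adj x y"
    then have xy: "x \<noteq> y" and "(x, y) \<in> adj_H" using adj_irrefl x y by (auto simp: adj_H_iff)
    then show "M x \<noteq> M y" using same[OF x y xy] cases[OF x y xy] by blast
    then show "M x \<inter> M y \<noteq> {}" using meet[OF x y] \<open>(x, y) \<in> adj_H\<close> by blast
  qed
qed

end

section \<open>Distances, subconstituents and regular points\<close>

lemma (in fin_digraph) unit_distance_eq_iff:
  "\<mu> (\<lambda>_. 1) u x = ereal (real n) \<longleftrightarrow>
    (\<exists>p. awalk u p x \<and> length p = n) \<and> (\<forall>p. awalk u p x \<longrightarrow> n \<le> length p)"
proof -
  have cost: "awalk_cost (\<lambda>_. 1) p = real (length p)" for p
    by (induction p) simp_all
  have min: "\<mu> (\<lambda>_. 1) u x \<le> ereal (real (length p))" if "awalk u p x" for p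
    using min_cost_le_walk_cost[OF that, of "\<lambda>_. 1"] by (simp add: cost)
  have attained: "\<exists>p. awalk u p x \<and> \<mu> (\<lambda>_. 1) u x = ereal (real (length p))" if "u \<rightarrow>\<^sup>* x"
    using min_cost_awalk[OF that, of "\<lambda>_. 1"] by (auto simp: cost apath_def)
  show ?thesis
  proof
    assume *: "\<mu> (\<lambda>_. 1) u x = ereal (real n)"
    then have "u \<rightarrow>\<^sup>* x" using shortest_path_inf[of u x "\<lambda>_. 1"] by fastforce
    then obtain p where "awalk u p x" "length p = n" using attained * by auto
    then show "(\<exists>p. awalk u p x \<and> length p = n) \<and> (\<forall>p. awalk u p x \<longrightarrow> n \<le> length p)"
      using min unfolding * by auto
  next
    assume *: "(\<exists>p. awalk u p x \<and> length p = n) \<and> (\<forall>p. awalk u p x \<longrightarrow> n \<le> length p)"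
    then obtain p where p: "awalk u p x" "length p = n" by blast
    then have "u \<rightarrow>\<^sup>* x" unfolding reachable_awalk by blast
    then obtain q where q: "awalk u q x" "\<mu> (\<lambda>_. 1) u x = ereal (real (length q))"
      using attained by blast
    then have "length q \<le> n" using min[OF p(1)] p(2) by simp
    moreover have "n \<le> length q" using * q(1) by blast
    ultimately show "\<mu> (\<lambda>_. 1) u x = ereal (real n)" using q(2) by simp
  qed
qed

lemma (in wf_digraph) awalk_length_1: "(\<exists>p. awalk u p x \<and> length p = 1) \<longleftrightarrow> u \<rightarrow>\<^bsub>G\<^esub> x"
proof
  assume "u \<rightarrow>\<^bsub>G\<^esub> x"
  then obtain e where "e \<in> arcs G" "tail G e = u" "head G e = x"
    by (auto simp: arcs_ends_conv)
  then show "\<exists>p. awalk u p x \<and> length p = 1"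
    by (intro exI[of _ "[e]"]) (auto simp: awalk_simps)
qed (auto simp: length_Suc_conv awalk_simps arcs_ends_conv image_iff)

lemma (in wf_digraph) awalk_length_2:
  assumes "u \<rightarrow>\<^bsub>G\<^esub> z" "z \<rightarrow>\<^bsub>G\<^esub> x"
  shows "\<exists>p. awalk u p x \<and> length p = 2"
proof -
  obtain e where e: "e \<in> arcs G" "tail G e = u" "head G e = z"
    using assms(1) by (auto simp: arcs_ends_conv)
  obtain f where f: "f \<in> arcs G" "tail G f = z" "head G f = x"
    using assms(2) by (auto simp: arcs_ends_conv)
  have "awalk u [e, f] x" using e f by (auto simp: awalk_simps)
  then show ?thesis by (intro exI[of _ "[e, f]"]) simp
qed

lemma arcs_ends_induce_subgraph:
  "arcs_ends (G \<restriction> S) = {(x, y) \<in> S \<times> S. x \<rightarrow>\<^bsub>G\<^esub> y}"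
  by (auto simp: arcs_ends_conv induce_subgraph_def)

lemma gq_parameter_graph_of_strongly_regular:
  assumes "2 \<le> t" "t \<le> s" "v \<in> verts G"
    and srg: "strongly_regular G ((t * s + 1) * (s + 1)) ((t + 1) * s) (s - 1) (t + 1)"
  shows "gq_parameter_graph (verts G) (\<lambda>x y. x \<rightarrow>\<^bsub>G\<^esub> y) s t v"
proof -
  interpret graph G using srg by (simp add: strongly_regular_def)
  have adj_verts: "x \<in> verts G \<and> y \<in> verts G" if "x \<rightarrow>\<^bsub>G\<^esub> y" for x y
    using that adj_in_verts by blast
  show ?thesis
  proof
    show "x \<in> verts G \<and> y \<in> verts G" "y \<rightarrow>\<^bsub>G\<^esub> x" if "x \<rightarrow>\<^bsub>G\<^esub> y" for x y
      using adj_verts that arcs_ends_symmetric[OF sym_arcs] by auto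
    show "\<not> x \<rightarrow>\<^bsub>G\<^esub> x" for x using adj_not_same by blast
    show "card {z \<in> verts G. x \<rightarrow>\<^bsub>G\<^esub> z \<and> y \<rightarrow>\<^bsub>G\<^esub> z} = s - 1" if "x \<rightarrow>\<^bsub>G\<^esub> y" for x y
      using srg that adj_verts[OF that] by (simp add: strongly_regular_def)
  qed (use assms in \<open>auto simp: strongly_regular_def mult.commute\<close>)
qed

context
  fixes G :: "('a, 'b) pre_digraph" and s t :: nat and v :: 'a
  assumes ts: "2 \<le> t" "t \<le> s" and v: "v \<in> verts G"
    and srg: "strongly_regular G ((t * s + 1) * (s + 1)) ((t + 1) * s) (s - 1) (t + 1)"
begin

interpretation graph G using srg by (simp add: strongly_regular_def)

interpretation \<Gamma>: gq_parameter_graph "verts G" "\<lambda>x y. x \<rightarrow>\<^bsub>G\<^esub> y" s t v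
  by (rule gq_parameter_graph_of_strongly_regular[OF ts v srg])

lemma subconstituent_1: "subconstituent G 1 v = G \<restriction> \<Gamma>.N"
proof -
  have "\<mu> (\<lambda>_. 1) v x = ereal (real 1) \<longleftrightarrow> v \<rightarrow>\<^bsub>G\<^esub> x" if "x \<in> verts G" for x
  proof -
    have "1 \<le> length p" if "v \<rightarrow>\<^bsub>G\<^esub> x" "awalk v p x" for p
      using that \<Gamma>.adj_irrefl by (cases p) (auto simp: awalk_Nil_iff)
    then show ?thesis unfolding unit_distance_eq_iff awalk_length_1 by blast
  qed
  then have "{x \<in> verts G. \<mu> (\<lambda>_. 1) v x = ereal (real 1)} = \<Gamma>.N"
    unfolding \<Gamma>.N_def by blast
  then show ?thesis unfolding subconstituent_def by simp
qed

text \<open>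
  The diameter is two, since nonadjacent vertices have a common neighbour.
\<close>
lemma subconstituent_2: "subconstituent G 2 v = G \<restriction> \<Gamma>.H"
proof -
  have "\<mu> (\<lambda>_. 1) v x = ereal (real 2) \<longleftrightarrow> x \<noteq> v \<and> \<not> v \<rightarrow>\<^bsub>G\<^esub> x" if x: "x \<in> verts G" for x
  proof
    assume "\<mu> (\<lambda>_. 1) v x = ereal (real 2)"
    then have long: "2 \<le> length p" if "awalk v p x" for p
      using that unfolding unit_distance_eq_iff by blast
    have "x \<noteq> v" using long[of "[]"] v by (auto simp: awalk_Nil_iff)
    moreover have "\<not> v \<rightarrow>\<^bsub>G\<^esub> x" using long awalk_length_1[of v x] by force
    ultimately show "x \<noteq> v \<and> \<not> v \<rightarrow>\<^bsub>G\<^esub> x" ..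
  next
    assume *: "x \<noteq> v \<and> \<not> v \<rightarrow>\<^bsub>G\<^esub> x"
    then have "card {z \<in> verts G. v \<rightarrow>\<^bsub>G\<^esub> z \<and> x \<rightarrow>\<^bsub>G\<^esub> z} = t + 1"
      using \<Gamma>.nonadjacent[OF v x] by auto
    then have "{z \<in> verts G. v \<rightarrow>\<^bsub>G\<^esub> z \<and> x \<rightarrow>\<^bsub>G\<^esub> z} \<noteq> {}" by (metis Suc_eq_plus1 card.empty nat.distinct(1))
    then obtain z where "v \<rightarrow>\<^bsub>G\<^esub> z" "z \<rightarrow>\<^bsub>G\<^esub> x" using \<Gamma>.adj_sym by blast
    then have "\<exists>p. awalk v p x \<and> length p = 2" by (rule awalk_length_2)
    moreover have "2 \<le> length p" if "awalk v p x" for p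
    proof (rule ccontr)
      assume "\<not> 2 \<le> length p"
      then consider "p = []" | "length p = 1" by (cases p) (auto simp: not_le less_Suc_eq)
      then show False
        using that * awalk_length_1[of v x] by cases (auto simp: awalk_Nil_iff)
    qed
    ultimately show "\<mu> (\<lambda>_. 1) v x = ereal (real 2)" unfolding unit_distance_eq_iff by blast
  qed
  then have "{x \<in> verts G. \<mu> (\<lambda>_. 1) v x = ereal (real 2)} = \<Gamma>.H"
    unfolding \<Gamma>.H_def by blast
  then show ?thesis unfolding subconstituent_def by simp
qed

lemma disjoint_union_of_cliques_iff:
  "disjoint_union_of_cliques (subconstituent G 1 v) \<longleftrightarrow> \<Gamma>.locally_cliques"
proof
  assume "disjoint_union_of_cliques (subconstituent G 1 v)"
  then obtain \<C> where part: "partition_on \<Gamma>.N \<C>"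
    and adj: "\<And>x y. x \<in> \<Gamma>.N \<Longrightarrow> y \<in> \<Gamma>.N \<Longrightarrow> x \<rightarrow>\<^bsub>G\<^esub> y \<longleftrightarrow> x \<noteq> y \<and> (\<exists>C\<in>\<C>. x \<in> C \<and> y \<in> C)"
    unfolding disjoint_union_of_cliques_def subconstituent_1 arcs_ends_induce_subgraph by auto
  have unique: "C = D" if "C \<in> \<C>" "D \<in> \<C>" "q \<in> C" "q \<in> D" for C D q
    using part that unfolding partition_on_def disjoint_def by blast
  show \<Gamma>.locally_cliques
    unfolding \<Gamma>.locally_cliques_def
  proof (intro ballI impI)
    fix p q r assume N: "p \<in> \<Gamma>.N" "q \<in> \<Gamma>.N" "r \<in> \<Gamma>.N" and pqr: "p \<rightarrow>\<^bsub>G\<^esub> q \<and> q \<rightarrow>\<^bsub>G\<^esub> r \<and> p \<noteq> r"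
    obtain C where C: "C \<in> \<C>" "p \<in> C" "q \<in> C" using adj[OF N(1,2)] pqr by blast
    obtain D where D: "D \<in> \<C>" "q \<in> D" "r \<in> D" using adj[OF N(2,3)] pqr by blast
    have "C = D" using unique C D by blast
    then show "p \<rightarrow>\<^bsub>G\<^esub> r" using adj[OF N(1,3)] C D pqr by blast
  qed
next
  assume cl: \<Gamma>.locally_cliques
  define r where "r = {(x, y) \<in> \<Gamma>.N \<times> \<Gamma>.N. x = y \<or> x \<rightarrow>\<^bsub>G\<^esub> y}"
  have "equiv \<Gamma>.N r"
  proof (rule equivI)
    show "r \<subseteq> \<Gamma>.N \<times> \<Gamma>.N" by (auto simp: r_def)
    show "refl_on \<Gamma>.N r" by (auto simp: r_def refl_on_def)
    show "sym r" using \<Gamma>.adj_sym by (auto simp: r_def sym_def)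
    show "trans r"
    proof (rule transI)
      fix x y z assume "(x, y) \<in> r" "(y, z) \<in> r"
      then show "(x, z) \<in> r" using cl unfolding \<Gamma>.locally_cliques_def r_def by blast
    qed
  qed
  have "x \<rightarrow>\<^bsub>G\<^esub> y \<longleftrightarrow> x \<noteq> y \<and> (\<exists>C\<in>\<Gamma>.N // r. x \<in> C \<and> y \<in> C)" if xy: "x \<in> \<Gamma>.N" "y \<in> \<Gamma>.N" for x y
  proof -
    have "(\<exists>C\<in>\<Gamma>.N // r. x \<in> C \<and> y \<in> C) \<longleftrightarrow> (x, y) \<in> r"
    proof
      assume "\<exists>C\<in>\<Gamma>.N // r. x \<in> C \<and> y \<in> C"
      then show "(x, y) \<in> r" using quotient_eq_iff[OF \<open>equiv \<Gamma>.N r\<close>] by blast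
    next
      assume "(x, y) \<in> r"
      then have "x \<in> r `` {x}" "y \<in> r `` {x}" using xy by (auto simp: r_def)
      then show "\<exists>C\<in>\<Gamma>.N // r. x \<in> C \<and> y \<in> C" using quotientI[OF xy(1), of r] by blast
    qed
    then show ?thesis using xy \<Gamma>.adj_irrefl by (auto simp: r_def)
  qed
  then show "disjoint_union_of_cliques (subconstituent G 1 v)"
    unfolding disjoint_union_of_cliques_def subconstituent_1 arcs_ends_induce_subgraph
    using partition_on_quotient[OF \<open>equiv \<Gamma>.N r\<close>] by (intro exI[of _ "\<Gamma>.N // r"]) auto
qed

lemma perp_eq_orth: "perp G X = \<Gamma>.orth X"
  by (simp add: perp_def \<Gamma>.orth_def)

lemma hyperbolic_lines_iff:
  "(\<forall>x\<in>verts G. x \<noteq> v \<and> \<not> v \<rightarrow>\<^bsub>G\<^esub> x \<longrightarrow>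
     coclique G (perp G (perp G {v, x})) \<and> card (perp G (perp G {v, x})) = t + 1)
   \<longleftrightarrow> \<Gamma>.long_hyperbolic_lines"
proof -
  have "perp G X \<subseteq> verts G" for X by (auto simp: perp_def)
  then show ?thesis
    unfolding \<Gamma>.long_hyperbolic_lines_def coclique_def perp_eq_orth[symmetric] \<Gamma>.H_def by blast
qed

lemma regular_point_iff_net: "regular_point G s t v \<longleftrightarrow> \<Gamma>.net_at_v"
proof -
  have verts: "verts (subconstituent G 2 v) = \<Gamma>.H"
    and ends: "arcs_ends (subconstituent G 2 v) = \<Gamma>.adj_H"
    by (simp_all add: subconstituent_2 arcs_ends_induce_subgraph \<Gamma>.adj_H_def)
  show ?thesis
  proof
    assume "regular_point G s t v"
    then obtain Rs where len: "length Rs = (if s = t then 4 else 5)" and Rs: "distinct Rs"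
      "Rs ! 0 = Id_on \<Gamma>.H" and Rs1: "Rs ! 1 = \<Gamma>.adj_H"
      and scheme: "symmetric_association_scheme \<Gamma>.H (set Rs)"
      "first_eigenmatrix \<Gamma>.H Rs (regP s t)"
      unfolding regular_point_def Let_def verts ends by blast
    have "regular_multiplication_table \<Gamma>.H s t (Rs ! 1) (Rs ! 2) (Rs ! 3) (if s = t then {} else Rs ! 4)"
      by (rule multiplication_table_of_eigenmatrix[OF ts \<Gamma>.card_H len Rs scheme])
    then show \<Gamma>.net_at_v unfolding Rs1 by (rule \<Gamma>.table_imp_net)
  next
    assume \<Gamma>.net_at_v
    then interpret T: regular_multiplication_table \<Gamma>.H s t \<Gamma>.adj_H \<Gamma>.meet_H \<Gamma>.same_H \<Gamma>.skew_H
      by (rule \<Gamma>.net_imp_table)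
    have "T.Rs ! 0 = Id_on \<Gamma>.H" "T.Rs ! 1 = \<Gamma>.adj_H" by (simp_all add: T.Rs_def)
    moreover have "strongly_regular G ((s + 1) * (s * t + 1)) (s * (t + 1)) (s - 1) (t + 1)"
      using srg by (simp only: mult.commute)
    ultimately show "regular_point G s t v"
      unfolding regular_point_def Let_def verts ends
      using ts v T.length_Rs T.distinct_Rs T.generates_scheme_Rs[OF verts ends]
        T.symmetric_association_scheme_Rs T.first_eigenmatrix_Rs
      by (intro conjI exI[of _ T.Rs]) (auto simp: generates_scheme_def verts ends)
  qed
qed

lemma regular_point_iff_local_conditions:
  "regular_point G s t v \<longleftrightarrow>
    disjoint_union_of_cliques (subconstituent G 1 v) \<and>
    (\<forall>x\<in>verts G. x \<noteq> v \<and> \<not> v \<rightarrow>\<^bsub>G\<^esub> x \<longrightarrow>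
       coclique G (perp G (perp G {v, x})) \<and> card (perp G (perp G {v, x})) = t + 1)"
  unfolding disjoint_union_of_cliques_iff hyperbolic_lines_iff regular_point_iff_net
  by (rule \<Gamma>.local_conditions_iff_net[symmetric])

end

theorem theorem6p1:
  fixes G :: "('a, 'b) pre_digraph" and s t :: nat and v :: 'a
  assumes "2 \<le> t" and "t \<le> s"
    and "strongly_regular G ((t * s + 1) * (s + 1)) ((t + 1) * s) (s - 1) (t + 1)"
    and "v \<in> verts G"
  shows "regular_point G s t v \<longleftrightarrow>
    disjoint_union_of_cliques (subconstituent G 1 v) \<and>
    (\<forall>x\<in>verts G. x \<noteq> v \<and> \<not> v \<rightarrow>\<^bsub>G\<^esub> x \<longrightarrow>
       coclique G (perp G (perp G {v, x})) \<and> card (perp G (perp G {v, x})) = t + 1)"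
  by (rule regular_point_iff_local_conditions[OF assms(1,2,4,3)])

end
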